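(* Let $(G,\sim,\mathcal{R})$ be a framed turbulence chart. There exists a gentle framed turbulence chart $(G',\sim',\mathcal{R}')$ equipped with a set $W$ of edges of $G'$ such that $(G,\sim,\mathcal{R})$ is obtained by deleting the edges of $W$ from $(G',\sim',\mathcal{R}')$ and then performing a number of contraction steps.
   Context: Graphs are finite undirected graphs (loops and multiple edges allowed), every vertex incident to at least one edge. A vertex is fringe if incident to exactly one edge (a loop counts twice), internal otherwise; an edge is fringe if incident to a fringe vertex. A half-edge is a pair $(e,v)$ with $v$ an endpoint of $e$; each edge has two half-edges. A turbulence chart $(G,\sim)$ is such a graph with, for each internal vertex $v$, an equivalence relation $\sim_v$ on the half-edges at $v$ with exactly two nonempty classes. A framing $\mathcal R$ assigns a linear order to each of the two classes of each $\sim_v$; $(G,\sim,\mathcal R)$ is a framed turbulence chart. An oriented edge is an ordering $\tilde e=e^te^h$ of the two half-edges of an edge $e$, from the vertex of $e^t$ to the vertex of $e^h$. A string is a sequence $\tilde e_1\cdots\tilde e_m$ of oriented edges with $h(\tilde e_j)=t(\tilde e_{j+1})$ and $e_j^h,e_{j+1}^t$ in different classes of $\sim_{h(\tilde e_j)}$. A band is a string $B$ such that $BB$ is a string and $B$ is not a power of a strictly shorter string. The chart is full if every class of every $\sim_v$ has exactly two elements. A half-edge is lonely if it is at a fringe vertex or is the only member of its class of $\sim_v$. A non-lonely half-edge is high if the other member of its class is below it in $\mathcal R$, low otherwise (for full charts). An oriented edge $e^te^h$ is ascending if $e^t$ is low or lonely and $e^h$ is high or lonely; descending if $e^t$ is high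 or lonely and $e^h$ is low or lonely. An edge is steep if one of its orientations is ascending or descending. A framed turbulence chart is gentle if (1) it is full, (2) every edge is incident to at least one internal vertex, (3) every edge is steep, and (4) no band consists entirely of ascending oriented edges or entirely of descending oriented edges. Deleting a set $W$ of edges removes those edges (and any vertices left incident to no edge), restricting the equivalence relations and orders to the remaining half-edges. An edge $\alpha$ is idle if it joins two distinct vertices $v_1\ne v_2$ and its half-edge $(\alpha,v_1)$ at the internal vertex $v_1$ is lonely. The contraction at $\alpha$ deletes $\alpha$, identifies $v_1$ and $v_2$ into one vertex $u$, and keeps all other data; at $u$, letting $f_1<\dots<f_{m_1}$ be the class of $\sim_{v_1}$ not containing $(\alpha,v_1)$, $g_1<\dots<g_{m_2}$ the class of $\sim_{v_2}$ containing $(\alpha,v_2)=g_a$, and $h_1<\dots<h_{m_3}$ the other class at $v_2$, the classes at $u$ are $h_1<\dots<h_{m_3}$ and $g_1<\dots<g_{a-1}<f_1<\dots<f_{m_1}<g_{a+1}<\dots<g_{m_2}$ (when $v_2$ is fringe, the resulting vertex simply carries the half-edges $f_1,\dots,f_{m_1}$). *)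

theory Defs
  imports Main
begin

text \<open>
  The two half-edges of an edge \<open>e\<close> are \<open>(e, False)\<close> and \<open>(e, True)\<close>, so that a loop also has two
  distinct half-edges; \<open>attach\<close> sends a half-edge to its vertex. Nothing below depends on which of
  the two half-edges carries which tag.
\<close>

type_synonym 'e half_edge = "'e \<times> bool"

record ('v, 'e) graph =
  verts :: "'v set"
  edges :: "'e set"
  attach :: "'e half_edge \<Rightarrow> 'v"

definition half_edges :: "('v, 'e, 'x) graph_scheme \<Rightarrow> 'e half_edge set" where
  "half_edges G = edges G \<times> UNIV"

definition half_edges_at :: "('v, 'e, 'x) graph_scheme \<Rightarrow> 'v \<Rightarrow> 'e half_edge set" where
  "half_edges_at G v = {x \<in> half_edges G. attach G x = v}"

fun other_half :: "'e half_edge \<Rightarrow> 'e half_edge" where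
  "other_half (e, b) = (e, \<not> b)"

definition finite_graph :: "('v, 'e, 'x) graph_scheme \<Rightarrow> bool" where
  "finite_graph G \<longleftrightarrow>
     finite (verts G) \<and> finite (edges G) \<and>
     (\<forall>x \<in> half_edges G. attach G x \<in> verts G) \<and>
     (\<forall>v \<in> verts G. half_edges_at G v \<noteq> {})"

definition fringe_vertex :: "('v, 'e, 'x) graph_scheme \<Rightarrow> 'v \<Rightarrow> bool" where
  "fringe_vertex G v \<longleftrightarrow> v \<in> verts G \<and> card (half_edges_at G v) = 1"

definition internal_vertex :: "('v, 'e, 'x) graph_scheme \<Rightarrow> 'v \<Rightarrow> bool" where
  "internal_vertex G v \<longleftrightarrow> v \<in> verts G \<and> \<not> fringe_vertex G v"


text \<open>
  The values of \<open>sim\<close> and \<open>framing\<close> only matter at internal vertices. The relation \<open>framing C v\<close> is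
  the union of the two (reflexive) linear orders on the classes of \<open>sim C v\<close>.
\<close>

record ('v, 'e) chart = "('v, 'e) graph" +
  sim :: "'v \<Rightarrow> 'e half_edge rel"

record ('v, 'e) framed_chart = "('v, 'e) chart" +
  framing :: "'v \<Rightarrow> 'e half_edge rel"

definition classes_at :: "('v, 'e, 'x) chart_scheme \<Rightarrow> 'v \<Rightarrow> 'e half_edge set set" where
  "classes_at C v = half_edges_at C v // sim C v"

definition turbulence_chart :: "('v, 'e, 'x) chart_scheme \<Rightarrow> bool" where
  "turbulence_chart C \<longleftrightarrow>
     finite_graph C \<and>
     (\<forall>v. internal_vertex C v \<longrightarrow>
        equiv (half_edges_at C v) (sim C v) \<and> card (classes_at C v) = 2)"

definition framed_turbulence_chart :: "('v, 'e) framed_chart \<Rightarrow> bool" where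
  "framed_turbulence_chart C \<longleftrightarrow>
     turbulence_chart C \<and>
     (\<forall>v. internal_vertex C v \<longrightarrow>
        framing C v \<subseteq> sim C v \<and>
        (\<forall>c \<in> classes_at C v. linear_order_on c (Restr (framing C v) c)))"


text \<open>An oriented edge is the pair of its tail half-edge and its head half-edge.\<close>

type_synonym 'e oriented_edge = "'e half_edge \<times> 'e half_edge"

definition oriented_edge :: "('v, 'e, 'x) graph_scheme \<Rightarrow> 'e oriented_edge \<Rightarrow> bool" where
  "oriented_edge G d \<longleftrightarrow> fst d \<in> half_edges G \<and> snd d = other_half (fst d)"

definition composable ::
  "('v, 'e, 'x) chart_scheme \<Rightarrow> 'e oriented_edge \<Rightarrow> 'e oriented_edge \<Rightarrow> bool" where
  "composable C d d' \<longleftrightarrow>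
     attach C (snd d) = attach C (fst d') \<and>
     internal_vertex C (attach C (snd d)) \<and>
     (snd d, fst d') \<notin> sim C (attach C (snd d))"

definition chart_string :: "('v, 'e, 'x) chart_scheme \<Rightarrow> 'e oriented_edge list \<Rightarrow> bool" where
  "chart_string C s \<longleftrightarrow>
     s \<noteq> [] \<and> (\<forall>d \<in> set s. oriented_edge C d) \<and>
     (\<forall>j. Suc j < length s \<longrightarrow> composable C (s ! j) (s ! Suc j))"

definition band :: "('v, 'e, 'x) chart_scheme \<Rightarrow> 'e oriented_edge list \<Rightarrow> bool" where
  "band C B \<longleftrightarrow>
     chart_string C B \<and> chart_string C (B @ B) \<and>
     \<not> (\<exists>A k. chart_string C A \<and> length A < length B \<and> B = concat (replicate k A))"


definition full_chart :: "('v, 'e, 'x) chart_scheme \<Rightarrow> bool" where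
  "full_chart C \<longleftrightarrow> (\<forall>v. internal_vertex C v \<longrightarrow> (\<forall>c \<in> classes_at C v. card c = 2))"

definition lonely :: "('v, 'e, 'x) chart_scheme \<Rightarrow> 'e half_edge \<Rightarrow> bool" where
  "lonely C x \<longleftrightarrow>
     x \<in> half_edges C \<and>
     (fringe_vertex C (attach C x) \<or> {x} \<in> classes_at C (attach C x))"

text \<open>High and low are meant for full charts, where a class has only one other member.\<close>

definition high :: "('v, 'e) framed_chart \<Rightarrow> 'e half_edge \<Rightarrow> bool" where
  "high C x \<longleftrightarrow>
     x \<in> half_edges C \<and> \<not> lonely C x \<and>
     (\<exists>y. y \<noteq> x \<and> (y, x) \<in> sim C (attach C x) \<and> (y, x) \<in> framing C (attach C x))"

definition low :: "('v, 'e) framed_chart \<Rightarrow> 'e half_edge \<Rightarrow> bool" where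
  "low C x \<longleftrightarrow> x \<in> half_edges C \<and> \<not> lonely C x \<and> \<not> high C x"

definition ascending :: "('v, 'e) framed_chart \<Rightarrow> 'e oriented_edge \<Rightarrow> bool" where
  "ascending C d \<longleftrightarrow>
     oriented_edge C d \<and>
     (low C (fst d) \<or> lonely C (fst d)) \<and> (high C (snd d) \<or> lonely C (snd d))"

definition descending :: "('v, 'e) framed_chart \<Rightarrow> 'e oriented_edge \<Rightarrow> bool" where
  "descending C d \<longleftrightarrow>
     oriented_edge C d \<and>
     (high C (fst d) \<or> lonely C (fst d)) \<and> (low C (snd d) \<or> lonely C (snd d))"

definition steep :: "('v, 'e) framed_chart \<Rightarrow> 'e \<Rightarrow> bool" where
  "steep C e \<longleftrightarrow>
     (\<exists>d. oriented_edge C d \<and> fst (fst d) = e \<and> (ascending C d \<or> descending C d))"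

definition gentle :: "('v, 'e) framed_chart \<Rightarrow> bool" where
  "gentle C \<longleftrightarrow>
     framed_turbulence_chart C \<and>
     full_chart C \<and>
     (\<forall>e \<in> edges C. \<exists>b. internal_vertex C (attach C (e, b))) \<and>
     (\<forall>e \<in> edges C. steep C e) \<and>
     \<not> (\<exists>B. band C B \<and> ((\<forall>d \<in> set B. ascending C d) \<or> (\<forall>d \<in> set B. descending C d)))"


text \<open>
  The outcome of a deletion need not be a turbulence chart again. At a vertex that has become fringe
  the leftover relations are ignored.
\<close>

definition delete_edges :: "('v, 'e) framed_chart \<Rightarrow> 'e set \<Rightarrow> ('v, 'e) framed_chart" where
  "delete_edges C W =
     (let H = (edges C - W) \<times> UNIV in
      \<lparr> verts = {v \<in> verts C. \<exists>x \<in> H. attach C x = v},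
        edges = edges C - W,
        attach = attach C,
        sim = (\<lambda>v. Restr (sim C v) H),
        framing = (\<lambda>v. Restr (framing C v) H) \<rparr>)"


text \<open>
  Here \<open>x\<close> is the half-edge \<open>(\<alpha>, v\<^sub>1)\<close> of an edge \<open>\<alpha>\<close>, and \<open>other_half x\<close> is \<open>(\<alpha>, v\<^sub>2)\<close>. If both
  half-edges of \<open>\<alpha>\<close> are lonely, both choices of \<open>v\<^sub>1\<close> may be available.
\<close>

definition idle_at :: "('v, 'e, 'x) chart_scheme \<Rightarrow> 'e half_edge \<Rightarrow> bool" where
  "idle_at C x \<longleftrightarrow>
     x \<in> half_edges C \<and> attach C x \<noteq> attach C (other_half x) \<and>
     internal_vertex C (attach C x) \<and> lonely C x"

text \<open>
  Contraction at the edge of an idle half-edge \<open>x\<close>; the merged vertex \<open>u\<close> reuses the name \<open>v\<^sub>2\<close>.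
  Since \<open>x\<close> is lonely, \<open>F\<close> is the other class at \<open>v\<^sub>1\<close>. \<open>K\<close> is the class of \<open>y = g\<^sub>a\<close> at \<open>v\<^sub>2\<close> without
  \<open>y\<close> itself, and \<open>L\<close> the other class at \<open>v\<^sub>2\<close>; both are empty when \<open>v\<^sub>2\<close> is fringe. The last two
  summands of the order insert \<open>F\<close> at the place of \<open>y\<close>.
\<close>

definition contract :: "('v, 'e) framed_chart \<Rightarrow> 'e half_edge \<Rightarrow> ('v, 'e) framed_chart" where
  "contract C x =
     (let y = other_half x;
          v1 = attach C x;
          v2 = attach C y;
          F = half_edges_at C v1 - {x};
          K = {z \<in> half_edges_at C v2. z \<noteq> y \<and> (z, y) \<in> sim C v2};
          L = half_edges_at C v2 - K - {y}
      in \<lparr> verts = verts C - {v1},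
           edges = edges C - {fst x},
           attach = (\<lambda>z. if attach C z = v1 then v2 else attach C z),
           sim = (sim C)(v2 := L \<times> L \<union> (K \<union> F) \<times> (K \<union> F)),
           framing = (framing C)(v2 :=
             Restr (framing C v2) L \<union> Restr (framing C v2) K \<union> Restr (framing C v1) F \<union>
             {k \<in> K. (k, y) \<in> framing C v2} \<times> F \<union>
             F \<times> {k \<in> K. (y, k) \<in> framing C v2}) \<rparr>)"

text \<open>
  Contracting towards a fringe vertex \<open>v\<^sub>2\<close> yields a chart only if \<open>F\<close> is a singleton; contraction
  steps are steps between framed turbulence charts.
\<close>

definition contraction_step :: "('v, 'e) framed_chart \<Rightarrow> ('v, 'e) framed_chart \<Rightarrow> bool" where
  "contraction_step C D \<longleftrightarrow>
     framed_turbulence_chart C \<and> framed_turbulence_chart D \<and>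
     (\<exists>x. idle_at C x \<and> D = contract C x)"


text \<open>
  The first condition on half-edges says that the bijection is induced by a bijection of edges, which
  may interchange the tags of an edge.
\<close>

definition chart_iso :: "('v, 'e) framed_chart \<Rightarrow> ('w, 'f) framed_chart \<Rightarrow> bool" where
  "chart_iso C D \<longleftrightarrow>
     (\<exists>\<phi> \<chi>.
        bij_betw \<phi> (verts C) (verts D) \<and>
        bij_betw \<chi> (half_edges C) (half_edges D) \<and>
        (\<forall>x \<in> half_edges C. \<chi> (other_half x) = other_half (\<chi> x)) \<and>
        (\<forall>x \<in> half_edges C. attach D (\<chi> x) = \<phi> (attach C x)) \<and>
        (\<forall>v. internal_vertex C v \<longrightarrow>
           (\<forall>x \<in> half_edges_at C v. \<forall>y \<in> half_edges_at C v.
              ((x, y) \<in> sim C v \<longleftrightarrow> (\<chi> x, \<chi> y) \<in> sim D (\<phi> v)) \<and>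
              ((x, y) \<in> framing C v \<longleftrightarrow> (\<chi> x, \<chi> y) \<in> framing D (\<phi> v)))))"

end

theory Submission
  imports Defs
begin

text \<open>
  Build the gentle chart backwards from the given one. Reversing a contraction splits off an order
  interval of a class as a new vertex; repeating this makes all classes have at most two elements, and
  the special case of one half-edge subdivides an edge. Declare each half-edge to be high or low,
  compatibly with the classes of two elements. Subdividing each edge at most twice, with suitable
  levels at the new vertices, makes the two ends of every edge have opposite levels and makes every
  edge have an end through which no ascending or descending string can be continued. Finally, complete
  every singleton class by an edge to a new fringe vertex. These edges form \<open>W\<close>; as they lie in no band,
  they cannot turn the interrupted strings into monotone bands.
\<close>

text \<open>The obstacle is the condition on bands. In a full chart every class has one low and one
  high member, so an ascending string that enters an internal vertex finds exactly one low half-edge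
  in the opposite class, and steepness lets it continue there; descending strings behave
  symmetrically. Hence monotone strings cannot simply be stopped at internal vertices: their
  continuation has to be forced into a fringe vertex. A subdivision vertex offers this. Both of its
  classes are singletons, so both levels are free, and they are chosen equal. A string that enters
  by one of the two old half-edges cannot leave monotonically by the other, and the partner added on
  completion, which has the opposite level, leads to a dead end. For this reason the levels are
  fixed before completion and the orders of the new pairs are read off from them. In a class of two
  elements the levels are dictated by the order. An edge whose ends have the wrong levels therefore
  cannot be relabelled in place and is subdivided instead.\<close>

subsection \<open>The data at an internal vertex\<close>

text \<open>Pointwise form of the chart axioms at one vertex, with classes replaced by conditions on
  elements so that modified relations can be checked pair by pair. The last two clauses express at
  least two and at most two classes; \<open>framed_pair_iff\<close> gives the equivalence with the
  quotient formulation.\<close>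

definition framed_pair :: "'a set \<Rightarrow> 'a rel \<Rightarrow> 'a rel \<Rightarrow> bool" where
  "framed_pair H S R \<longleftrightarrow>
     S \<subseteq> H \<times> H \<and> R \<subseteq> S \<and>
     (\<forall>x\<in>H. (x, x) \<in> R) \<and>
     (\<forall>x y. (x, y) \<in> S \<longrightarrow> (x, y) \<in> R \<or> (y, x) \<in> R) \<and>
     (\<forall>x y. (x, y) \<in> R \<longrightarrow> (y, x) \<in> R \<longrightarrow> x = y) \<and>
     (\<forall>x y z. (x, y) \<in> R \<longrightarrow> (y, z) \<in> R \<longrightarrow> (x, z) \<in> R) \<and>
     (\<forall>x y. (x, y) \<in> S \<longrightarrow> (y, x) \<in> S) \<and>
     (\<forall>x y z. (x, y) \<in> S \<longrightarrow> (y, z) \<in> S \<longrightarrow> (x, z) \<in> S) \<and>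
     (\<exists>x\<in>H. \<exists>y\<in>H. (x, y) \<notin> S) \<and>
     (\<forall>x\<in>H. \<forall>y\<in>H. \<forall>z\<in>H. (x, y) \<in> S \<or> (y, z) \<in> S \<or> (x, z) \<in> S)"

lemma framed_pairD:
  assumes "framed_pair H S R"
  shows framed_pair_field: "(x, y) \<in> S \<Longrightarrow> x \<in> H \<and> y \<in> H"
    and framed_pair_le: "(x, y) \<in> R \<Longrightarrow> (x, y) \<in> S"
    and framed_pair_refl: "x \<in> H \<Longrightarrow> (x, x) \<in> R"
    and framed_pair_total: "(x, y) \<in> S \<Longrightarrow> (x, y) \<in> R \<or> (y, x) \<in> R"
    and framed_pair_antisym: "(x, y) \<in> R \<Longrightarrow> (y, x) \<in> R \<Longrightarrow> x = y"
    and framed_pair_trans: "(x, y) \<in> R \<Longrightarrow> (y, z) \<in> R \<Longrightarrow> (x, z) \<in> R"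
    and framed_pair_sym: "(x, y) \<in> S \<Longrightarrow> (y, x) \<in> S"
    and framed_pair_sim_trans: "(x, y) \<in> S \<Longrightarrow> (y, z) \<in> S \<Longrightarrow> (x, z) \<in> S"
    and framed_pair_two: "x \<in> H \<Longrightarrow> y \<in> H \<Longrightarrow> z \<in> H \<Longrightarrow> (x, y) \<in> S \<or> (y, z) \<in> S \<or> (x, z) \<in> S"
    and framed_pair_nontrivial: "\<exists>x\<in>H. \<exists>y\<in>H. (x, y) \<notin> S"
proof -
  from assms have S: "S \<subseteq> H \<times> H" and R: "R \<subseteq> S" and r: "\<forall>x\<in>H. (x, x) \<in> R"
    and t: "\<forall>x y. (x, y) \<in> S \<longrightarrow> (x, y) \<in> R \<or> (y, x) \<in> R"
    and a: "\<forall>x y. (x, y) \<in> R \<longrightarrow> (y, x) \<in> R \<longrightarrow> x = y"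
    and tr: "\<forall>x y z. (x, y) \<in> R \<longrightarrow> (y, z) \<in> R \<longrightarrow> (x, z) \<in> R"
    and s: "\<forall>x y. (x, y) \<in> S \<longrightarrow> (y, x) \<in> S"
    and st: "\<forall>x y z. (x, y) \<in> S \<longrightarrow> (y, z) \<in> S \<longrightarrow> (x, z) \<in> S"
    and n: "\<exists>x\<in>H. \<exists>y\<in>H. (x, y) \<notin> S"
    and two: "\<forall>x\<in>H. \<forall>y\<in>H. \<forall>z\<in>H. (x, y) \<in> S \<or> (y, z) \<in> S \<or> (x, z) \<in> S"
    unfolding framed_pair_def by - (elim conjE, assumption)+
  show "(x, y) \<in> S \<Longrightarrow> x \<in> H \<and> y \<in> H" using S by blast
  show "(x, y) \<in> R \<Longrightarrow> (x, y) \<in> S" using R by blast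
  show "x \<in> H \<Longrightarrow> (x, x) \<in> R" using r by blast
  show "(x, y) \<in> S \<Longrightarrow> (x, y) \<in> R \<or> (y, x) \<in> R" using t by blast
  show "(x, y) \<in> R \<Longrightarrow> (y, x) \<in> R \<Longrightarrow> x = y" using a by blast
  show "(x, y) \<in> R \<Longrightarrow> (y, z) \<in> R \<Longrightarrow> (x, z) \<in> R" using tr by blast
  show "(x, y) \<in> S \<Longrightarrow> (y, x) \<in> S" using s by blast
  show "(x, y) \<in> S \<Longrightarrow> (y, z) \<in> S \<Longrightarrow> (x, z) \<in> S" using st by blast
  show "x \<in> H \<Longrightarrow> y \<in> H \<Longrightarrow> z \<in> H \<Longrightarrow> (x, y) \<in> S \<or> (y, z) \<in> S \<or> (x, z) \<in> S" using two by blast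
  show "\<exists>x\<in>H. \<exists>y\<in>H. (x, y) \<notin> S" using n .
qed

lemma framed_pairI:
  assumes "\<And>x y. (x, y) \<in> S \<Longrightarrow> x \<in> H \<and> y \<in> H"
    and "\<And>x y. (x, y) \<in> R \<Longrightarrow> (x, y) \<in> S"
    and "\<And>x. x \<in> H \<Longrightarrow> (x, x) \<in> R"
    and "\<And>x y. (x, y) \<in> S \<Longrightarrow> (x, y) \<in> R \<or> (y, x) \<in> R"
    and "\<And>x y. (x, y) \<in> R \<Longrightarrow> (y, x) \<in> R \<Longrightarrow> x = y"
    and "\<And>x y z. (x, y) \<in> R \<Longrightarrow> (y, z) \<in> R \<Longrightarrow> (x, z) \<in> R"
    and "\<And>x y. (x, y) \<in> S \<Longrightarrow> (y, x) \<in> S"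
    and "\<And>x y z. (x, y) \<in> S \<Longrightarrow> (y, z) \<in> S \<Longrightarrow> (x, z) \<in> S"
    and "\<exists>x\<in>H. \<exists>y\<in>H. (x, y) \<notin> S"
    and "\<And>x y z. x \<in> H \<Longrightarrow> y \<in> H \<Longrightarrow> z \<in> H \<Longrightarrow> (x, y) \<in> S \<or> (y, z) \<in> S \<or> (x, z) \<in> S"
  shows "framed_pair H S R"
  unfolding framed_pair_def
  apply (intro conjI allI ballI impI)
  subgoal using assms(1) by auto
  subgoal using assms(2) by auto
  subgoal using assms(3) by blast
  subgoal using assms(4) by blast
  subgoal using assms(5) by blast
  subgoal using assms(6) by blast
  subgoal using assms(7) by blast
  subgoal using assms(8) by blast
  subgoal using assms(9) by blast
  subgoal using assms(10) by blast
  done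

lemma framed_pair_other_class:
  assumes "framed_pair H S R" "x \<in> H"
  obtains y where "y \<in> H" "(x, y) \<notin> S"
  using framed_pair_nontrivial[OF assms(1)] framed_pair_sym[OF assms(1)]
    framed_pair_sim_trans[OF assms(1)] by meson

text \<open>Pigeonhole: with at most two classes, two of any three elements share a class.
  Conversely, the classes of one unrelated pair exhaust the quotient.\<close>

lemma card_quotient_eq_2_iff:
  assumes "equiv H S"
  shows "card (H // S) = 2 \<longleftrightarrow>
     (\<exists>x\<in>H. \<exists>y\<in>H. (x, y) \<notin> S) \<and>
     (\<forall>x\<in>H. \<forall>y\<in>H. \<forall>z\<in>H. (x, y) \<in> S \<or> (y, z) \<in> S \<or> (x, z) \<in> S)"
    (is "?L \<longleftrightarrow> ?R")
proof
  have eq: "S `` {x} = S `` {y} \<longleftrightarrow> (x, y) \<in> S" if "x \<in> H" "y \<in> H" for x y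
    using eq_equiv_class_iff[OF assms that] .
  {
    assume ?L
    then obtain A B where AB: "H // S = {A, B}" "A \<noteq> B"
      by (meson card_2_iff)
    obtain x y where x: "x \<in> H" "A = S `` {x}" and y: "y \<in> H" "B = S `` {y}"
      by (metis AB(1) insertI1 insertI2 quotientE)
    have "S `` {z} = A \<or> S `` {z} = B" if "z \<in> H" for z
      using quotientI[OF that, of S] AB(1) by auto
    then show ?R
      using x y AB(2) eq by metis
  }
  {
    assume ?R
    then obtain x y where xy: "x \<in> H" "y \<in> H" "(x, y) \<notin> S"
      and two: "\<And>z. z \<in> H \<Longrightarrow> (y, z) \<in> S \<or> (x, z) \<in> S" by metis
    have "S `` {z} = S `` {x} \<or> S `` {z} = S `` {y}" if "z \<in> H" for z
      using two[OF that] eq that xy by metis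
    then have "H // S = {S `` {x}, S `` {y}}"
      using xy unfolding quotient_def by auto
    moreover have "S `` {x} \<noteq> S `` {y}"
      using eq xy by blast
    ultimately show ?L
      by simp
  }
qed

text \<open>Because \<open>R\<close> is contained in \<open>S\<close>, every chain of comparable
  elements stays in the class of its first member. The order axioms on the single classes therefore
  yield those for \<open>R\<close> on all of \<open>H\<close>.\<close>

lemma framed_pair_iff:
  "framed_pair H S R \<longleftrightarrow>
     equiv H S \<and> card (H // S) = 2 \<and> R \<subseteq> S \<and> (\<forall>c \<in> H // S. linear_order_on c (Restr R c))"
    (is "?L \<longleftrightarrow> ?R")
proof
  assume L: ?L
  note S_field = framed_pair_field[OF L] and S_sym = framed_pair_sym[OF L]
    and S_trans = framed_pair_sim_trans[OF L] and R_le = framed_pair_le[OF L]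
    and R_refl = framed_pair_refl[OF L]
  have eq: "equiv H S"
    by (intro equivI refl_onI symI transI subrelI)
      (use S_field S_sym S_trans R_le R_refl in \<open>blast+\<close>)
  moreover have "linear_order_on c (Restr R c)" if cl: "c \<in> H // S" for c
  proof -
    obtain x where x: "x \<in> H" "c = S `` {x}" using cl by (rule quotientE)
    have c: "a \<in> H \<and> (x, a) \<in> S" if "a \<in> c" for a
      using x that S_field by blast
    have "trans (Restr R c)"
      by (rule transI) (use framed_pair_trans[OF L] in blast)
    moreover have "antisym (Restr R c)"
      by (rule antisymI) (use framed_pair_antisym[OF L] in blast)
    moreover have "total_on c (Restr R c)"
    proof (rule total_onI)
      fix a b assume ab: "a \<in> c" "b \<in> c"
      then have "(a, b) \<in> S"
        using c S_sym S_trans by meson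
      then show "(a, b) \<in> Restr R c \<or> (b, a) \<in> Restr R c"
        using framed_pair_total[OF L] ab by blast
    qed
    moreover have "refl_on c (Restr R c)"
      by (rule refl_onI) (use c R_refl in blast)
    ultimately show ?thesis
      unfolding order_on_defs by blast
  qed
  moreover have "card (H // S) = 2"
    using card_quotient_eq_2_iff[OF eq] framed_pair_nontrivial[OF L] framed_pair_two[OF L] by blast
  ultimately show ?R
    using R_le by auto
next
  assume R: ?R
  then have eq: "equiv H S" and RS: "R \<subseteq> S"
    and lin: "\<And>x. x \<in> H \<Longrightarrow> linear_order_on (S `` {x}) (Restr R (S `` {x}))"
    by (auto simp: quotientI)
  have S: "S \<subseteq> H \<times> H" "refl_on H S" "sym S" "trans S"
    using eq by (auto elim: equivE)
  have 1: "(x, x) \<in> R" if "x \<in> H" for x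
    using lin[OF that] S(2) that unfolding order_on_defs refl_on_def by blast
  have 2: "(x, y) \<in> R \<or> (y, x) \<in> R" if "(x, y) \<in> S" for x y
  proof (cases "x = y")
    case False
    have m: "x \<in> H" "x \<in> S `` {x}" "y \<in> S `` {x}"
      using that S(1,2) unfolding refl_on_def by blast+
    have "total_on (S `` {x}) (Restr R (S `` {x}))"
      using lin[OF m(1)] unfolding order_on_defs by blast
    then show ?thesis
      using m(2,3) False unfolding total_on_def by blast
  qed (use that S(1) 1 in blast)
  have 3: "x = y" if "(x, y) \<in> R" "(y, x) \<in> R" for x y
  proof -
    have "(x, y) \<in> S" "(x, x) \<in> S" "x \<in> H"
      using that RS S(1,2) unfolding refl_on_def by blast+
    then show ?thesis
      using lin[of x] that unfolding order_on_defs antisym_def by blast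
  qed
  have 4: "(x, z) \<in> R" if "(x, y) \<in> R" "(y, z) \<in> R" for x y z
  proof -
    have m: "(x, y) \<in> S" "(x, z) \<in> S" "(x, x) \<in> S" "x \<in> H"
      using that RS S(1,2) transD[OF S(4)] unfolding refl_on_def by blast+
    have "trans (Restr R (S `` {x}))"
      using lin[OF m(4)] unfolding order_on_defs by blast
    then have "(x, z) \<in> Restr R (S `` {x})"
      by (rule transD[of _ x y z]) (use m that in auto)
    then show ?thesis by blast
  qed
  show ?L
  proof (rule framed_pairI)
    show "\<exists>x\<in>H. \<exists>y\<in>H. (x, y) \<notin> S"
      using R card_quotient_eq_2_iff[OF eq] by blast
    show "(x, y) \<in> S \<or> (y, z) \<in> S \<or> (x, z) \<in> S" if "x \<in> H" "y \<in> H" "z \<in> H" for x y z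
      using R card_quotient_eq_2_iff[OF eq] that by blast
    show "x \<in> H \<and> y \<in> H" if "(x, y) \<in> S" for x y
      using that S(1) by blast
    show "(x, y) \<in> S" if "(x, y) \<in> R" for x y
      using that RS by blast
  qed (fact 1 2 3 4 symD[OF S(3)] transD[OF S(4)])+
qed

lemma framed_turbulence_chart_iff:
  "framed_turbulence_chart C \<longleftrightarrow>
     finite_graph C \<and>
     (\<forall>v. internal_vertex C v \<longrightarrow> framed_pair (half_edges_at C v) (sim C v) (framing C v))"
  unfolding framed_turbulence_chart_def turbulence_chart_def classes_at_def framed_pair_iff by blast

lemma framed_pair_at:
  "framed_turbulence_chart C \<Longrightarrow> internal_vertex C v \<Longrightarrow>
    framed_pair (half_edges_at C v) (sim C v) (framing C v)"
  by (simp add: framed_turbulence_chart_iff)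

text \<open>Covers relabelling (with a bijection) as well as restriction to a subset meeting both classes.\<close>

lemma framed_pair_pullback:
  assumes "framed_pair H S R" "inj_on p H'" "p ` H' \<subseteq> H"
    and "\<exists>x\<in>H'. \<exists>y\<in>H'. (p x, p y) \<notin> S"
  shows "framed_pair H' {(x, y) \<in> H' \<times> H'. (p x, p y) \<in> S} {(x, y) \<in> H' \<times> H'. (p x, p y) \<in> R}"
proof (rule framed_pairI, goal_cases)
  case (1 x y) then show ?case by blast
next
  case (2 x y) then show ?case using framed_pair_le[OF assms(1)] by blast
next
  case (3 x) then show ?case using framed_pair_refl[OF assms(1)] assms(3) by blast
next
  case (4 x y) then show ?case using framed_pair_total[OF assms(1)] by blast
next
  case (5 x y)
  then have "p x = p y" using framed_pair_antisym[OF assms(1)] by blast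
  then show ?case using 5 inj_onD[OF assms(2)] by blast
next
  case (6 x y z) then show ?case using framed_pair_trans[OF assms(1), of "p x" "p y" "p z"] by blast
next
  case (7 x y) then show ?case using framed_pair_sym[OF assms(1)] by blast
next
  case (8 x y z) then show ?case using framed_pair_sim_trans[OF assms(1), of "p x" "p y" "p z"] by blast
next
  case 9 then show ?case using assms(4) by blast
next
  case (10 x y z)
  then have "p x \<in> H" "p y \<in> H" "p z \<in> H" using assms(3) by auto
  then show ?case using 10 framed_pair_two[OF assms(1)] by blast
qed

subsection \<open>Charts up to irrelevant values\<close>

lemma half_edges_at_iff: "x \<in> half_edges_at G v \<longleftrightarrow> fst x \<in> edges G \<and> attach G x = v"
  by (cases x) (auto simp: half_edges_at_def half_edges_def)

lemma half_edges_iff: "x \<in> half_edges G \<longleftrightarrow> fst x \<in> edges G"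
  by (cases x) (auto simp: half_edges_def)

lemma fst_other_half [simp]: "fst (other_half x) = fst x"
  by (cases x) simp

lemma other_half_other_half [simp]: "other_half (other_half x) = x"
  by (cases x) simp

lemma other_half_neq: "other_half x \<noteq> x"
  by (cases x) simp

lemma fst_eq_cases: "fst z = fst x \<Longrightarrow> z = x \<or> z = other_half x"
  by (cases x; cases z) auto

lemma internal_vertex_iff: "internal_vertex G v \<longleftrightarrow> v \<in> verts G \<and> card (half_edges_at G v) \<noteq> 1"
  by (auto simp: internal_vertex_def fringe_vertex_def)

lemma finite_half_edges_at: "finite_graph G \<Longrightarrow> finite (half_edges_at G v)"
  unfolding finite_graph_def half_edges_at_def half_edges_def by auto

lemma internal_vertexI:
  assumes "finite_graph G" "v \<in> verts G" "x \<in> half_edges_at G v" "y \<in> half_edges_at G v" "x \<noteq> y"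
  shows "internal_vertex G v"
  using assms by (auto simp: internal_vertex_iff card_1_singleton_iff)

lemma fringe_half_edge_unique:
  assumes "\<not> internal_vertex G v" "v \<in> verts G" "x \<in> half_edges_at G v" "y \<in> half_edges_at G v"
  shows "x = y"
  using assms by (auto simp: internal_vertex_iff card_1_singleton_iff)

lemma ex_half_edge:
  "finite_graph G \<Longrightarrow> v \<in> verts G \<Longrightarrow> \<exists>z. fst z \<in> edges G \<and> attach G z = v"
  unfolding finite_graph_def by (meson all_not_in_conv half_edges_at_iff)

definition agree :: "('v, 'e) framed_chart \<Rightarrow> ('v, 'e) framed_chart \<Rightarrow> bool" where
  "agree A B \<longleftrightarrow>
     verts A = verts B \<and> edges A = edges B \<and> (\<forall>x \<in> half_edges B. attach A x = attach B x) \<and>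
     (\<forall>v. internal_vertex B v \<longrightarrow> sim A v = sim B v \<and> framing A v = framing B v)"

lemma agree_half_edges_at: "agree A B \<Longrightarrow> half_edges_at A v = half_edges_at B v"
  by (auto simp: agree_def half_edges_at_iff half_edges_iff)

lemma agree_internal_vertex: "agree A B \<Longrightarrow> internal_vertex A v = internal_vertex B v"
  unfolding internal_vertex_iff by (simp add: agree_half_edges_at) (simp add: agree_def)

lemma agree_trans: "agree A B \<Longrightarrow> agree B C \<Longrightarrow> agree A C"
  using agree_internal_vertex[of B C] by (auto simp: agree_def half_edges_def)

lemma agree_framed:
  assumes "agree A B" "framed_turbulence_chart B"
  shows "framed_turbulence_chart A"
proof -
  have "finite_graph A"
    using assms agree_half_edges_at[OF assms(1)] unfolding framed_turbulence_chart_iff finite_graph_def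
    by (auto simp: agree_def half_edges_def)
  then show ?thesis
    using assms agree_internal_vertex[OF assms(1)] agree_half_edges_at[OF assms(1)]
    unfolding framed_turbulence_chart_iff agree_def by simp
qed

lemma agree_idle:
  assumes "agree A B" "framed_turbulence_chart B" "idle_at B x"
  shows "idle_at A x"
proof -
  have x: "x \<in> half_edges B" "other_half x \<in> half_edges B"
    using assms(3) by (auto simp: idle_at_def half_edges_iff)
  then have at: "attach A x = attach B x" "attach A (other_half x) = attach B (other_half x)"
    using assms(1) by (auto simp: agree_def)
  have "half_edges A = half_edges B"
    using assms(1) by (simp add: agree_def half_edges_def)
  moreover have "classes_at A (attach B x) = classes_at B (attach B x)"
    using assms agree_half_edges_at[OF assms(1)] by (simp add: classes_at_def agree_def idle_at_def)
  moreover have "fringe_vertex A (attach B x) = fringe_vertex B (attach B x)"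
    using assms agree_half_edges_at[OF assms(1)] by (simp add: agree_def fringe_vertex_def)
  ultimately show ?thesis
    using assms(3) agree_internal_vertex[OF assms(1)] x
    unfolding idle_at_def lonely_def at by simp
qed

lemma contract_graph_simps:
  "verts (contract C x) = verts C - {attach C x}"
  "edges (contract C x) = edges C - {fst x}"
  "attach (contract C x) z = (if attach C z = attach C x then attach C (other_half x) else attach C z)"
  by (simp_all add: contract_def Let_def)

text \<open>Only the merged vertex needs care, since \<open>contract\<close> reads the relations at
  \<open>v2\<close> even when \<open>v2\<close> is fringe and the two charts may differ there. In
  that case \<open>y\<close> is the only half-edge at \<open>v2\<close>, so \<open>K\<close> and
  \<open>L\<close> are empty in both charts.\<close>

lemma agree_contract:
  assumes "agree A B" "framed_turbulence_chart B" "idle_at B x"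
  shows "agree (contract A x) (contract B x)"
proof -
  let ?y = "other_half x"
  let ?v1 = "attach B x" and ?v2 = "attach B ?y"
  have x: "x \<in> half_edges B" "?y \<in> half_edges B" "?v1 \<noteq> ?v2" "internal_vertex B ?v1"
    using assms(3) by (auto simp: idle_at_def half_edges_iff)
  have at: "\<And>x. x \<in> half_edges B \<Longrightarrow> attach A x = attach B x"
    using assms(1) by (auto simp: agree_def)
  have ve: "verts A = verts B" "edges A = edges B"
    using assms(1) by (auto simp: agree_def)
  have H: "half_edges_at A v = half_edges_at B v" for v
    by (rule agree_half_edges_at[OF assms(1)])
  have sf: "sim A v = sim B v" "framing A v = framing B v" if "internal_vertex B v" for v
    using assms(1) that by (auto simp: agree_def)
  define K where "K C = {z \<in> half_edges_at B ?v2. z \<noteq> ?y \<and> (z, ?y) \<in> sim C ?v2}"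
    for C :: "('a, 'b) framed_chart"
  have fringe: "half_edges_at B ?v2 = {?y}" if "\<not> internal_vertex B ?v2"
  proof -
    have "?v2 \<in> verts B" "?y \<in> half_edges_at B ?v2"
      using assms(2) x by (auto simp: framed_turbulence_chart_iff finite_graph_def half_edges_at_iff half_edges_iff)
    then show ?thesis
      using fringe_half_edge_unique[OF that] by blast
  qed
  have K: "K A = K B"
    unfolding K_def using fringe sf by (cases "internal_vertex B ?v2") auto
  have R2: "Restr (framing A ?v2) (half_edges_at B ?v2 - M - {?y}) = Restr (framing B ?v2) (half_edges_at B ?v2 - M - {?y})" for M
    using fringe sf by (cases "internal_vertex B ?v2") auto
  have R3: "Restr (framing A ?v2) (K B) = Restr (framing B ?v2) (K B)"
    "{k \<in> K B. (k, ?y) \<in> framing A ?v2} = {k \<in> K B. (k, ?y) \<in> framing B ?v2}"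
    "{k \<in> K B. (?y, k) \<in> framing A ?v2} = {k \<in> K B. (?y, k) \<in> framing B ?v2}"
    using fringe sf unfolding K_def by (cases "internal_vertex B ?v2"; auto)+
  \<comment> \<open>Away from the merged vertex contraction changes no set of half-edges, so an
    internal vertex of the result was internal before, where the two charts agree.\<close>
  have int: "internal_vertex B v" if "internal_vertex (contract B x) v" "v \<noteq> ?v2" for v
  proof -
    have v: "v \<in> verts B" "v \<noteq> ?v1"
      using that(1) by (auto simp: contract_graph_simps internal_vertex_iff)
    have "fst z \<noteq> fst x" if "attach B z = v" for z
      using fst_eq_cases[of z x] that v(2) \<open>v \<noteq> ?v2\<close> by auto
    then have "half_edges_at (contract B x) v = half_edges_at B v"
      using v(2) \<open>v \<noteq> ?v2\<close>
      by (intro set_eqI) (simp add: contract_graph_simps half_edges_at_iff, metis)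
    with v(1) have "half_edges_at (contract B x) v = half_edges_at B v" "v \<in> verts B"
      by simp_all
    then show ?thesis
      using that(1) by (simp add: internal_vertex_iff)
  qed
  show ?thesis
    unfolding agree_def
    apply (intro conjI ballI allI impI)
    subgoal using at x ve by (simp add: contract_graph_simps)
    subgoal using at x ve by (simp add: contract_graph_simps)
    subgoal for z using at x ve by (auto simp: contract_graph_simps half_edges_iff)
    subgoal for v
      using sf[OF int[of v]] K unfolding contract_def Let_def H
      by (simp add: at x K_def[symmetric])
    subgoal for v
      using sf[OF int[of v]] sf[of ?v1] K unfolding contract_def Let_def H
      by (simp add: at x K_def[symmetric] R2 R3)
    done
qed

text \<open>
  Contracting an expansion restores a chart only up to the values of the relations at vertices that
  are fringe or absent, hence \<^const>\<open>agree\<close> instead of equality.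
\<close>

definition realizable :: "(nat, nat) framed_chart \<Rightarrow> bool" where
  "realizable D \<longleftrightarrow>
     (\<exists>C' W D'. gentle C' \<and> W \<subseteq> edges C' \<and> contraction_step\<^sup>*\<^sup>* (delete_edges C' W) D' \<and> agree D' D)"

text \<open>The contraction at \<open>x\<close> becomes the last step of the sequence. It is carried
  out on a chart that only agrees with \<open>E\<close>, so idleness and the result have to be
  transferred along \<open>agree\<close>.\<close>

lemma realizable_contract:
  assumes "realizable E" "framed_turbulence_chart E" "idle_at E x"
    and "agree (contract E x) D" "framed_turbulence_chart D"
  shows "realizable D"
proof -
  obtain C' W D' where D': "gentle C'" "W \<subseteq> edges C'" "contraction_step\<^sup>*\<^sup>* (delete_edges C' W) D'" "agree D' E"
    using assms(1) by (auto simp: realizable_def)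
  have ag: "agree (contract D' x) D"
    using agree_trans[OF agree_contract[OF D'(4) assms(2,3)] assms(4)] .
  have "contraction_step D' (contract D' x)"
    using agree_framed[OF D'(4) assms(2)] agree_framed[OF ag assms(5)] agree_idle[OF D'(4) assms(2,3)]
    unfolding contraction_step_def by blast
  then show ?thesis
    unfolding realizable_def using D'(1-3) ag by (meson rtranclp.rtrancl_into_rtrancl)
qed

subsection \<open>Reversing a contraction\<close>

text \<open>
  The new vertex \<open>w\<close> takes over the set \<open>F\<close> of half-edges at \<open>v\<close>. At \<open>v\<close> the new half-edge
  \<open>(a, True)\<close> stands for \<open>F\<close> and inherits the position of its representative \<open>f\<close>; at \<open>w\<close> the
  half-edge \<open>(a, False)\<close> is lonely. If \<open>F = {f}\<close>, this subdivides the edge of \<open>f\<close>.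
\<close>

definition expand ::
  "('v, 'e) framed_chart \<Rightarrow> 'v \<Rightarrow> 'e half_edge set \<Rightarrow> 'e half_edge \<Rightarrow> 'v \<Rightarrow> 'e \<Rightarrow> ('v, 'e) framed_chart" where
  "expand D v F f w a =
     (let y = (a, True);
          x = (a, False);
          H = insert y (half_edges_at D v - F);
          p = (\<lambda>z. if z = y then f else z)
      in \<lparr> verts = insert w (verts D),
           edges = insert a (edges D),
           attach = (\<lambda>z. if z = y then v else if z = x \<or> z \<in> F then w else attach D z),
           sim = (sim D)(v := {(z, z') \<in> H \<times> H. (p z, p z') \<in> sim D v}, w := {(x, x)} \<union> F \<times> F),
           framing = (framing D)
             (v := {(z, z') \<in> H \<times> H. (p z, p z') \<in> framing D v},
              w := {(x, x)} \<union> Restr (framing D v) F \<union> Id_on F) \<rparr>)"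

text \<open>The two convexity assumptions say that every half-edge outside \<open>F\<close> lies on
  the same side of all members of \<open>F\<close>. This is what lets the single half-edge
  \<open>y\<close> keep the position of the whole of \<open>F\<close>. At a fringe vertex the
  relations carry no information, so there \<open>F\<close> has to be the only half-edge.\<close>

locale expansion =
  fixes D :: "('v, 'e) framed_chart" and v :: 'v and F :: "'e half_edge set" and f :: "'e half_edge"
    and w :: 'v and a :: 'e
  assumes framed: "framed_turbulence_chart D"
    and v: "v \<in> verts D" and w: "w \<notin> verts D" and a: "a \<notin> edges D"
    and f: "f \<in> F" and F: "F \<subseteq> half_edges_at D v"
    and fringe: "\<not> internal_vertex D v \<Longrightarrow> F = {f}"
    and same_class: "\<lbrakk>internal_vertex D v; g \<in> F; g' \<in> F\<rbrakk> \<Longrightarrow> (g, g') \<in> sim D v"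
    and convex_below: "\<lbrakk>internal_vertex D v; k \<in> half_edges_at D v - F; g \<in> F; g' \<in> F; (k, g) \<in> framing D v\<rbrakk>
      \<Longrightarrow> (k, g') \<in> framing D v"
    and convex_above: "\<lbrakk>internal_vertex D v; k \<in> half_edges_at D v - F; g \<in> F; g' \<in> F; (g, k) \<in> framing D v\<rbrakk>
      \<Longrightarrow> (g', k) \<in> framing D v"
begin

abbreviation "E \<equiv> expand D v F f w a"
abbreviation "x \<equiv> (a, False)"
abbreviation "y \<equiv> (a, True)"
abbreviation "p \<equiv> (\<lambda>z. if z = y then f else z)"

lemma fresh: "w \<noteq> v" "x \<notin> half_edges_at D u" "y \<notin> half_edges_at D u" "x \<notin> F" "y \<notin> F" "f \<in> half_edges_at D v"
  using v w a f F by (auto simp: half_edges_at_iff)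

lemma F_attach: "z \<in> F \<Longrightarrow> fst z \<in> edges D \<and> attach D z = v"
  using F by (auto simp: half_edges_at_iff)

lemma attach_verts: "fst z \<in> edges D \<Longrightarrow> attach D z \<in> verts D"
  using framed by (cases z) (auto simp: framed_turbulence_chart_iff finite_graph_def half_edges_iff)

lemma expand_graph_simps:
  "verts E = insert w (verts D)"
  "edges E = insert a (edges D)"
  "attach E z = (if z = y then v else if z = x \<or> z \<in> F then w else attach D z)"
  by (simp_all add: expand_def Let_def)

lemma half_edges_at_expand:
  "half_edges_at E u =
     (if u = v then insert y (half_edges_at D v - F) else if u = w then insert x F else half_edges_at D u)"
proof -
  have "z \<noteq> x" "z \<noteq> y" if "fst z \<in> edges D" for z
    using a that by auto
  moreover have "z = x \<or> z = y" if "fst z = a" for z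
    using that by (cases z) auto
  ultimately show ?thesis
    using fresh(1,4,5) F_attach w attach_verts a
    by (auto simp: half_edges_at_iff expand_graph_simps split: if_splits)
qed

lemma sim_expand:
  "sim E u = (if u = w then {(x, x)} \<union> F \<times> F else if u = v then
     {(z, z') \<in> half_edges_at E v \<times> half_edges_at E v. (p z, p z') \<in> sim D v} else sim D u)"
  unfolding half_edges_at_expand by (auto simp: expand_def Let_def)

lemma framing_expand:
  "framing E u = (if u = w then {(x, x)} \<union> Restr (framing D v) F \<union> Id_on F else if u = v then
     {(z, z') \<in> half_edges_at E v \<times> half_edges_at E v. (p z, p z') \<in> framing D v} else framing D u)"
  unfolding half_edges_at_expand by (auto simp: expand_def Let_def)

lemma finite_expand: "finite_graph E"
proof -
  have D: "finite (verts D)" "finite (edges D)"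
    "\<And>u. u \<in> verts D \<Longrightarrow> half_edges_at D u \<noteq> {}"
    using framed by (auto simp: framed_turbulence_chart_iff finite_graph_def)
  show ?thesis
    unfolding finite_graph_def
  proof (intro conjI ballI)
    show "attach E z \<in> verts E" if "z \<in> half_edges E" for z
      using that v attach_verts by (cases z) (auto simp: half_edges_iff expand_graph_simps)
    show "half_edges_at E u \<noteq> {}" if "u \<in> verts E" for u
      using that D(3) by (auto simp: half_edges_at_expand expand_graph_simps)
  qed (use D in \<open>auto simp: expand_graph_simps\<close>)
qed

lemma at_v: "internal_vertex D v \<Longrightarrow> framed_pair (half_edges_at D v) (sim D v) (framing D v)"
  by (rule framed_pair_at[OF framed])

lemma other_class:
  assumes "internal_vertex D v"
  obtains z where "z \<in> half_edges_at D v - F" "(f, z) \<notin> sim D v"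
  using framed_pair_other_class[OF at_v[OF assms] fresh(6)] same_class[OF assms f] by blast

text \<open>Since \<open>F\<close> lies inside one class, an internal \<open>v\<close> keeps
  \<open>y\<close> together with the whole other class, while a fringe \<open>v\<close> merely
  exchanges \<open>f\<close> for \<open>y\<close>. The vertex \<open>w\<close> carries
  \<open>x\<close> and \<open>f\<close>.\<close>

lemma internal_expand: "internal_vertex E u \<longleftrightarrow> u = w \<or> internal_vertex D u"
proof -
  consider "u = w" | "u = v" "internal_vertex D v" | "u = v" "\<not> internal_vertex D v" | "u \<noteq> v" "u \<noteq> w"
    by blast
  then show ?thesis
  proof cases
    case 1
    then show ?thesis
      using internal_vertexI[OF finite_expand, of w x f] fresh f
      by (auto simp: half_edges_at_expand expand_graph_simps)
  next
    case 2
    obtain z where "z \<in> half_edges_at D v - F"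
      using other_class[OF 2(2)] .
    then show ?thesis
      using 2 internal_vertexI[OF finite_expand, of v y z] fresh v
      by (auto simp: half_edges_at_expand expand_graph_simps)
  next
    case 3
    have "half_edges_at D v - F = {}"
      using fringe[OF 3(2)] fringe_half_edge_unique[OF 3(2) v fresh(6)] by blast
    then have "half_edges_at E v = {y}"
      unfolding half_edges_at_expand by auto
    then show ?thesis
      using 3 fresh(1) by (simp add: internal_vertex_iff)
  next
    case 4
    then show ?thesis
      by (simp add: internal_vertex_iff half_edges_at_expand expand_graph_simps)
  qed
qed

lemma inj_p: "inj_on p (half_edges_at E v)"
  using f by (auto simp: inj_on_def half_edges_at_expand)

lemma p_neq: "b \<in> half_edges_at E v \<Longrightarrow> c \<in> half_edges_at E v \<Longrightarrow> b \<noteq> c \<Longrightarrow> p b \<noteq> p c"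
  using inj_onD[OF inj_p] by blast

lemma framed_expand_v:
  assumes "internal_vertex D v"
  shows "framed_pair (half_edges_at E v) (sim E v) (framing E v)"
proof -
  obtain z where z: "z \<in> half_edges_at D v - F" "(f, z) \<notin> sim D v"
    using other_class[OF assms] .
  note inj_p
  moreover have "p ` half_edges_at E v \<subseteq> half_edges_at D v"
    using fresh by (auto simp: half_edges_at_expand)
  moreover have "\<exists>z\<in>half_edges_at E v. \<exists>z'\<in>half_edges_at E v. (p z, p z') \<notin> sim D v"
    using z fresh by (intro bexI[of _ y] bexI[of _ z]) (auto simp: half_edges_at_expand)
  moreover have
    "sim E v = {(z, z') \<in> half_edges_at E v \<times> half_edges_at E v. (p z, p z') \<in> sim D v}"
    "framing E v = {(z, z') \<in> half_edges_at E v \<times> half_edges_at E v. (p z, p z') \<in> framing D v}"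
    using fresh(1) unfolding sim_expand framing_expand by auto
  ultimately show ?thesis
    using framed_pair_pullback[OF at_v[OF assms], of p "half_edges_at E v"] by (simp only:)
qed

lemma framed_expand_w: "framed_pair (half_edges_at E w) (sim E w) (framing E w)"
proof (cases "internal_vertex D v")
  \<comment> \<open>At a fringe vertex \<open>framing D v\<close> is arbitrary; the summand
    \<open>Id_on F\<close> in \<open>expand\<close> supplies reflexivity at
    \<open>f\<close>.\<close>
  case False
  then have "half_edges_at E w = {x, f}" "sim E w = {(x, x), (f, f)}" "framing E w = {(x, x), (f, f)}"
    using fringe[OF False] fresh(1) unfolding half_edges_at_expand sim_expand framing_expand by auto
  moreover have "x \<noteq> f"
    using fresh(4) f by blast
  ultimately show ?thesis
    by (intro framed_pairI) auto
next
  case True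
  note A = at_v[OF True]
  show ?thesis
  proof (rule framed_pairI, goal_cases)
    case (4 z z')
    then show ?case
      using framed_pair_total[OF A, of z z'] same_class[OF True, of z z'] by (auto simp: sim_expand framing_expand)
  next
    case (5 z z')
    then show ?case
      using framed_pair_antisym[OF A, of z z'] by (auto simp: framing_expand)
  next
    case (6 z z' z'')
    then show ?case
      using framed_pair_trans[OF A, of z z' z''] fresh(4) by (auto simp: framing_expand)
  qed (use f fresh in \<open>auto simp: half_edges_at_expand sim_expand framing_expand\<close>)
qed

lemma framed_expand: "framed_turbulence_chart E"
  unfolding framed_turbulence_chart_iff
proof (intro conjI allI impI finite_expand)
  fix u assume u: "internal_vertex E u"
  show "framed_pair (half_edges_at E u) (sim E u) (framing E u)"
  proof (cases "u = v \<or> u = w")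
    case True
    then show ?thesis
      using u framed_expand_v framed_expand_w fresh(1) by (auto simp: internal_expand)
  next
    case False
    then show ?thesis
      using u framed_pair_at[OF framed] by (simp add: internal_expand half_edges_at_expand sim_expand framing_expand)
  qed
qed

lemma idle_expand: "idle_at E x"
proof -
  have "x \<in> half_edges_at E w" "sim E w `` {x} = {x}"
    using fresh by (auto simp: half_edges_at_expand sim_expand)
  then have "{x} \<in> classes_at E w"
    unfolding classes_at_def by (metis quotientI)
  then show ?thesis
    using fresh(1) by (auto simp: idle_at_def lonely_def internal_expand expand_graph_simps half_edges_iff)
qed

text \<open>The contraction removes the vertex of \<open>x\<close>, which is \<open>w\<close>, and
  keeps the name \<open>v\<close>, so the old names return literally. \<open>K\<close> and
  \<open>F\<close> together form the old class of \<open>f\<close>, \<open>L\<close> is the other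
  class, and convexity turns comparisons with \<open>y\<close> into comparisons with each member of
  \<open>F\<close>.\<close>

lemma contract_expand: "agree (contract E x) D"
proof -
  let ?H = "half_edges_at D v"
  define K where "K = {z \<in> half_edges_at E v. z \<noteq> y \<and> (z, y) \<in> sim E v}"
  have oh: "other_half x = y"
    by simp
  have att: "attach E x = w" "attach E y = v"
    by (simp_all add: expand_graph_simps)
  have Fw: "half_edges_at E w - {x} = F"
    using fresh by (auto simp: half_edges_at_expand)
  have K: "K = {z \<in> ?H - F. (z, f) \<in> sim D v}"
    using fresh by (auto simp: K_def half_edges_at_expand sim_expand)
  define L where "L = half_edges_at E v - K - {y}"
  have L: "L = {z \<in> ?H - F. (z, f) \<notin> sim D v}"
    using fresh by (auto simp: L_def K half_edges_at_expand)
  have sim_c: "sim (contract E x) = (sim E)(v := L \<times> L \<union> (K \<union> F) \<times> (K \<union> F))"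
    unfolding contract_def Let_def oh att Fw K_def[symmetric] L_def[symmetric] by simp
  have fr_c: "framing (contract E x) = (framing E)(v :=
             Restr (framing E v) L \<union> Restr (framing E v) K \<union> Restr (framing E w) F \<union>
             {k \<in> K. (k, y) \<in> framing E v} \<times> F \<union>
             F \<times> {k \<in> K. (y, k) \<in> framing E v})"
    unfolding contract_def Let_def oh att Fw K_def[symmetric] L_def[symmetric] by simp
  have sim_v: "L \<times> L \<union> (K \<union> F) \<times> (K \<union> F) = sim D v" if i: "internal_vertex D v"
  proof -
    note A = at_v[OF i]
    have KF: "K \<union> F = {z \<in> ?H. (z, f) \<in> sim D v}"
      using K F same_class[OF i _ f] by blast
    have L': "L = {z \<in> ?H. (z, f) \<notin> sim D v}"
      using L same_class[OF i _ f] by blast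
    \<comment> \<open>With only two classes, two half-edges are related exactly when both or neither
      are related to \<open>f\<close>.\<close>
    have iff: "(b, c) \<in> sim D v \<longleftrightarrow> b \<in> ?H \<and> c \<in> ?H \<and> ((b, f) \<in> sim D v \<longleftrightarrow> (c, f) \<in> sim D v)" for b c
      using framed_pair_field[OF A, of b c] framed_pair_two[OF A, of b c f]
        framed_pair_sym[OF A, of b c] framed_pair_sym[OF A, of c f]
        framed_pair_sim_trans[OF A, of b c f] framed_pair_sim_trans[OF A, of c b f]
        framed_pair_sim_trans[OF A, of b f c] fresh(6) by blast
    have "(b, c) \<in> L \<times> L \<union> (K \<union> F) \<times> (K \<union> F) \<longleftrightarrow> (b, c) \<in> sim D v" for b c
      unfolding KF L' using iff[of b c] by blast
    then show ?thesis
      by auto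
  qed
  have fr_v: "Restr (framing E v) L \<union> Restr (framing E v) K \<union> Restr (framing E w) F \<union>
      {k \<in> K. (k, y) \<in> framing E v} \<times> F \<union> F \<times> {k \<in> K. (y, k) \<in> framing E v} = framing D v" (is "?M = _")
    if i: "internal_vertex D v"
  proof -
    note A = at_v[OF i]
    have "(b, c) \<in> framing E v \<longleftrightarrow> (b, c) \<in> framing D v" if "b \<in> ?H - F" "c \<in> ?H - F" for b c
      using that fresh(1) fresh(3)[of v] by (auto simp: framing_expand half_edges_at_expand)
    then have EL: "Restr (framing E v) M = Restr (framing D v) M" if "M \<subseteq> ?H - F" for M
      using that by blast
    have EK: "Restr (framing E v) K = Restr (framing D v) K"
      by (rule EL) (use K in blast)
    have EL': "Restr (framing E v) L = Restr (framing D v) L"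
      by (rule EL) (use L in blast)
    have EF: "Restr (framing E w) F = Restr (framing D v) F"
      using fresh F framed_pair_refl[OF A] by (auto simp: framing_expand)
    have Ky: "{k \<in> K. (k, y) \<in> framing E v} = {k \<in> K. (k, f) \<in> framing D v}"
      "{k \<in> K. (y, k) \<in> framing E v} = {k \<in> K. (f, k) \<in> framing D v}"
      using fresh by (auto simp: framing_expand half_edges_at_expand K)
    have M: "?M = Restr (framing D v) L \<union> Restr (framing D v) K \<union> Restr (framing D v) F \<union>
      {k \<in> K. (k, f) \<in> framing D v} \<times> F \<union> F \<times> {k \<in> K. (f, k) \<in> framing D v}"
      unfolding EF Ky EK EL' ..
    have sub: "(b, c) \<in> L \<times> L \<union> (K \<union> F) \<times> (K \<union> F)" if "(b, c) \<in> framing D v" for b c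
      using framed_pair_le[OF A that] sim_v[OF i] by blast
    have KH: "K \<subseteq> ?H - F"
      using K by blast
    have "(b, c) \<in> ?M \<longleftrightarrow> (b, c) \<in> framing D v" for b c
    proof
      assume bc: "(b, c) \<in> ?M"
      show "(b, c) \<in> framing D v"
        using bc[unfolded M] convex_below[OF i, of b f c] convex_above[OF i, of c f b] KH f by auto
    next
      assume bc: "(b, c) \<in> framing D v"
      show "(b, c) \<in> ?M"
        unfolding M
        using sub[OF bc] bc convex_below[OF i, of b c f] convex_above[OF i, of c b f] KH f by auto
    qed
    then show ?thesis by auto
  qed
  have u: "u \<noteq> w" if "internal_vertex D u" for u
    using that w by (auto simp: internal_vertex_iff)
  show ?thesis
    unfolding agree_def
  proof (intro conjI ballI allI impI)
    show "verts (contract E x) = verts D"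
      using w by (auto simp: contract_graph_simps expand_graph_simps)
    show "edges (contract E x) = edges D"
      using a by (auto simp: contract_graph_simps expand_graph_simps)
    show "attach (contract E x) z = attach D z" if "z \<in> half_edges D" for z
      using that a w F_attach[of z] attach_verts[of z]
      by (auto simp: contract_graph_simps expand_graph_simps half_edges_iff)
    show "sim (contract E x) u = sim D u" if "internal_vertex D u" for u
      using sim_v that u[OF that] unfolding sim_c by (auto simp: sim_expand)
    show "framing (contract E x) u = framing D u" if "internal_vertex D u" for u
    proof (cases "u = v")
      case True
      show ?thesis
        unfolding fr_c True fun_upd_same using fr_v that True by blast
    next
      case False
      then show ?thesis
        unfolding fr_c using u[OF that] by (simp add: framing_expand)
    qed
  qed
qed

end

lemma realizable_expand:
  assumes "expansion D v F f w a" "realizable (expand D v F f w a)"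
  shows "realizable D"
  using realizable_contract[OF assms(2) expansion.framed_expand expansion.idle_expand
      expansion.contract_expand expansion.framed] assms(1) by blast

subsection \<open>Reduction to classes of at most two half-edges\<close>

lemma framed_pair_finite_least:
  assumes "framed_pair H S R" "finite A" "A \<noteq> {}" "\<And>b c. b \<in> A \<Longrightarrow> c \<in> A \<Longrightarrow> (b, c) \<in> S"
  obtains m where "m \<in> A" "\<And>b. b \<in> A \<Longrightarrow> (m, b) \<in> R"
proof -
  have "\<exists>m\<in>A. \<forall>b\<in>A. (m, b) \<in> R"
    using assms(2-4)
  proof (induction rule: finite_ne_induct)
    case (singleton b)
    then show ?case
      using framed_pair_total[OF assms(1), of b b] by blast
  next
    case (insert b A)
    then obtain m where m: "m \<in> A" "\<forall>c\<in>A. (m, c) \<in> R" by blast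
    have bb: "(b, b) \<in> R"
      using framed_pair_total[OF assms(1), of b b] insert.prems by blast
    have "(b, m) \<in> S"
      using insert.prems m(1) by blast
    then show ?case
      using framed_pair_total[OF assms(1), of b m] framed_pair_trans[OF assms(1), of b m] m bb by blast
  qed
  then show ?thesis using that by blast
qed

text \<open>By antisymmetry \<open>c\<close> also differs from \<open>z\<close>, so these are the
  half-edges of rank at least three in their class. Their number measures how far the classes are
  from having at most two elements.\<close>

definition third_or_higher :: "('v, 'e) framed_chart \<Rightarrow> 'e half_edge set" where
  "third_or_higher C =
     {z. \<exists>v b c. internal_vertex C v \<and> c \<noteq> b \<and> b \<noteq> z \<and> (c, b) \<in> framing C v \<and> (b, z) \<in> framing C v}"

lemma third_or_higherI:
  "\<lbrakk>internal_vertex C v; (c, b) \<in> framing C v; (b, z) \<in> framing C v; c \<noteq> b; b \<noteq> z\<rbrakk>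
    \<Longrightarrow> z \<in> third_or_higher C"
  unfolding third_or_higher_def by blast

lemma finite_third_or_higher:
  assumes "framed_turbulence_chart C"
  shows "finite (third_or_higher C)"
proof (rule finite_subset)
  show "third_or_higher C \<subseteq> half_edges C"
  proof
    fix z assume "z \<in> third_or_higher C"
    then obtain v b where v: "internal_vertex C v" "(b, z) \<in> framing C v"
      unfolding third_or_higher_def by blast
    note A = framed_pair_at[OF assms v(1)]
    show "z \<in> half_edges C"
      using framed_pair_field[OF A framed_pair_le[OF A v(2)]] by (simp add: half_edges_at_def)
  qed
  show "finite (half_edges C)"
    using assms by (simp add: framed_turbulence_chart_iff finite_graph_def half_edges_def)
qed

lemma obtain_fresh:
  assumes "finite_graph (D :: (nat, nat, 'x) graph_scheme)"
  obtains w a where "w \<notin> verts D" "a \<notin> edges D"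
  using assms ex_new_if_finite[OF infinite_UNIV_nat] unfolding finite_graph_def by metis

text \<open>
  Expand along a class without its least element; the least member of \<^const>\<open>third_or_higher\<close> in that
  class then has only one predecessor left.
\<close>

lemma expansion_decreases_third_or_higher:
  fixes D :: "(nat, nat) framed_chart"
  assumes D: "framed_turbulence_chart D" and ne: "third_or_higher D \<noteq> {}"
  obtains v F f w a where "expansion D v F f w a"
    "card (third_or_higher (expand D v F f w a)) < card (third_or_higher D)"
proof -
  obtain z v b c where iv: "internal_vertex D v" and
    z: "c \<noteq> b" "b \<noteq> z" "(c, b) \<in> framing D v" "(b, z) \<in> framing D v"
    using ne unfolding third_or_higher_def by blast
  note A = framed_pair_at[OF D iv]
  note A_field = framed_pair_field[OF A] and A_le = framed_pair_le[OF A]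
    and A_sym = framed_pair_sym[OF A] and A_trans = framed_pair_sim_trans[OF A]
    and A_antisym = framed_pair_antisym[OF A]
  have fin: "finite_graph D"
    using D by (simp add: framed_turbulence_chart_iff)
  obtain w a where wa: "w \<notin> verts D" "a \<notin> edges D"
    using obtain_fresh[OF fin] .
  define cl where "cl = {u. (u, z) \<in> sim D v}"
  have cl_sim: "(g, g') \<in> sim D v" if "g \<in> cl" "g' \<in> cl" for g g'
    using that A_sym A_trans unfolding cl_def by blast
  have cl_H: "cl \<subseteq> half_edges_at D v"
    using A_field unfolding cl_def by blast
  then have fin_cl: "finite cl"
    using finite_half_edges_at[OF fin] finite_subset by blast
  have cl_closed: "g \<in> cl \<longleftrightarrow> g' \<in> cl" if "(g, g') \<in> sim D v" for g g'
    using that A_sym A_trans unfolding cl_def by blast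
  have bz: "b \<in> cl" "z \<in> cl" "c \<in> cl"
    using z A_le A_sym A_trans unfolding cl_def by blast+
  obtain m where m: "m \<in> cl" "\<And>u. u \<in> cl \<Longrightarrow> (m, u) \<in> framing D v"
    using framed_pair_finite_least[OF A fin_cl] cl_sim bz by blast
  have zup: "z \<in> third_or_higher D"
    unfolding third_or_higher_def using iv z by blast
  obtain z0 where z0: "z0 \<in> cl \<inter> third_or_higher D"
    "\<And>u. u \<in> cl \<inter> third_or_higher D \<Longrightarrow> (z0, u) \<in> framing D v"
    using framed_pair_finite_least[OF A, of "cl \<inter> third_or_higher D"] fin_cl cl_sim bz zup by blast
  \<comment> \<open>What remains outside \<open>F\<close> is \<open>m\<close>, which lies below its
    whole class, and the other class, which is incomparable to \<open>F\<close>; this makes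
    \<open>F\<close> convex.\<close>
  define F where "F = cl - {m}"
  have zF: "z \<in> F"
    using m(2)[OF bz(1)] A_antisym z bz unfolding F_def by blast
  interpret expansion D v F z w a
  proof
    show "F \<subseteq> half_edges_at D v"
      using cl_H F_def by blast
    show "(g, g') \<in> sim D v" if "g \<in> F" "g' \<in> F" for g g'
      using that cl_sim F_def by blast
    show "(k, g') \<in> framing D v"
      if "k \<in> half_edges_at D v - F" "g \<in> F" "g' \<in> F" "(k, g) \<in> framing D v" for k g g'
      using that A_le cl_closed m(2) unfolding F_def by blast
    show "(g', k) \<in> framing D v"
      if "k \<in> half_edges_at D v - F" "g \<in> F" "g' \<in> F" "(g, k) \<in> framing D v" for k g g'
      using that A_le cl_closed m(2) A_antisym unfolding F_def by blast
  qed (use D wa iv zF in \<open>auto simp: internal_vertex_iff\<close>)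
  have "third_or_higher E \<subseteq> third_or_higher D - {z0}"
  proof
    fix u assume "u \<in> third_or_higher E"
    then obtain v' b' c' where v': "internal_vertex E v'" "c' \<noteq> b'" "b' \<noteq> u"
      "(c', b') \<in> framing E v'" "(b', u) \<in> framing E v'"
      unfolding third_or_higher_def by blast
    consider "v' = w" | "v' = v" | "v' \<noteq> w" "v' \<noteq> v" by blast
    then show "u \<in> third_or_higher D - {z0}"
    proof cases
      case 1
      have *: "(c', b') \<in> framing D v" "(b', u) \<in> framing D v" "c' \<in> F" "b' \<in> F"
        using v' fresh(4) unfolding 1 framing_expand by auto
      \<comment> \<open>In \<open>D\<close> the element \<open>m\<close> still precedes
        \<open>c'\<close>, so \<open>b'\<close> already has rank at least three there. Hence
        \<open>z0\<close> is at most \<open>b'\<close> and strictly below \<open>u\<close>.\<close>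
      have "(m, c') \<in> framing D v" "m \<noteq> c'"
        using m(2)[of c'] *(3) unfolding F_def by blast+
      then have "b' \<in> third_or_higher D"
        using third_or_higherI[OF iv _ *(1)] v'(2) by blast
      then have "(z0, b') \<in> framing D v"
        using z0(2) *(4) F_def by blast
      then have "u \<noteq> z0"
        using A_antisym[OF *(2)] v'(3) by blast
      then show ?thesis
        using third_or_higherI[OF iv *(1,2)] v'(2,3) by blast
    next
      case 2
      have *: "(p c', p b') \<in> framing D v" "(p b', p u) \<in> framing D v"
        "c' \<in> half_edges_at E v" "b' \<in> half_edges_at E v" "u \<in> half_edges_at E v"
        using v' fresh(1) unfolding 2 framing_expand by auto
      have d: "p c' \<noteq> p b'" "p b' \<noteq> p u"
        using p_neq[OF *(3,4) v'(2)] p_neq[OF *(4,5) v'(3)] .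
      then have d': "p c' \<noteq> p u"
        using A_antisym[OF *(1)] *(2) by auto
      \<comment> \<open>At \<open>v\<close> the class of \<open>z\<close> shrinks to
        \<open>m\<close> and \<open>y\<close>, on which \<open>p\<close> takes only the values
        \<open>m\<close> and \<open>z\<close>. A strict chain of three elements must therefore lie
        in the other class, where \<open>p\<close> is the identity.\<close>
      have p_cl: "p g \<in> {z, m}" if "g \<in> half_edges_at E v" "p g \<in> cl" for g
      proof -
        have "g = y \<or> g \<notin> F"
          using that(1) by (auto simp: half_edges_at_expand)
        then show ?thesis
          using that(2) unfolding F_def by auto
      qed
      have three: False if "r \<in> {z, m}" "s \<in> {z, m}" "t \<in> {z, m}" "r \<noteq> s" "s \<noteq> t" "r \<noteq> t" for r s t
        using that by auto
      have nc: "p c' \<notin> cl \<or> p b' \<notin> cl \<or> p u \<notin> cl"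
        using three[OF p_cl[OF *(3)] p_cl[OF *(4)] p_cl[OF *(5)] d d'] by argo
      have c1: "p c' \<in> cl \<longleftrightarrow> p b' \<in> cl"
        by (rule cl_closed[OF A_le[OF *(1)]])
      have c2: "p b' \<in> cl \<longleftrightarrow> p u \<in> cl"
        by (rule cl_closed[OF A_le[OF *(2)]])
      have "p c' \<notin> cl" "p b' \<notin> cl" "p u \<notin> cl"
        using nc c1 c2 by blast+
      then have "p c' = c'" "p b' = b'" "p u = u" "u \<notin> cl"
        using bz(2) by (auto split: if_splits)
      then show ?thesis
        using third_or_higherI[OF iv *(1,2)] v'(2,3) z0(1) by auto
    next
      case 3
      then have i: "internal_vertex D v'" "(c', b') \<in> framing D v'" "(b', u) \<in> framing D v'"
        using v' by (simp_all add: internal_expand framing_expand)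
      note A' = framed_pair_at[OF D i(1)]
      have "u \<in> half_edges_at D v'"
        using framed_pair_field[OF A' framed_pair_le[OF A' i(3)]] by blast
      then have "u \<notin> cl"
        using cl_H 3(2) by (auto simp: half_edges_at_iff)
      then show ?thesis
        using third_or_higherI[OF i] v'(2,3) z0(1) by blast
    qed
  qed
  then have "third_or_higher E \<subset> third_or_higher D"
    using z0(1) by blast
  then have "card (third_or_higher E) < card (third_or_higher D)"
    using psubset_card_mono[OF finite_third_or_higher[OF D]] by blast
  then show ?thesis
    using that expansion_axioms by blast
qed

lemma realizable_if_small_classes:
  assumes "\<And>D. framed_turbulence_chart D \<Longrightarrow> third_or_higher D = {} \<Longrightarrow> realizable D"
    and "framed_turbulence_chart D"
  shows "realizable D"
  using assms(2)
proof (induction "card (third_or_higher D)" arbitrary: D rule: less_induct)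
  case less
  show ?case
  proof (cases "third_or_higher D = {}")
    case True
    then show ?thesis
      using assms(1) less.prems by blast
  next
    case False
    then obtain v F f w a where e: "expansion D v F f w a"
      "card (third_or_higher (expand D v F f w a)) < card (third_or_higher D)"
      using expansion_decreases_third_or_higher[OF less.prems] by blast
    have "realizable (expand D v F f w a)"
      by (rule less.hyps[OF e(2) expansion.framed_expand[OF e(1)]])
    then show ?thesis
      using realizable_expand[OF e(1)] by blast
  qed
qed

subsection \<open>Subdividing edges\<close>

text \<open>
  \<open>T z\<close> says that the half-edge \<open>z\<close> is to be high in the gentle chart under construction, which leaves a
  choice for half-edges that are alone in their class or at a fringe vertex.
\<close>

definition levels :: "('v, 'e) framed_chart \<Rightarrow> ('e half_edge \<Rightarrow> bool) \<Rightarrow> bool" where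
  "levels C T \<longleftrightarrow>
     (\<forall>v b c. internal_vertex C v \<longrightarrow> (b, c) \<in> framing C v \<longrightarrow> b \<noteq> c \<longrightarrow> \<not> T b \<and> T c)"

lemma levelsD:
  "levels C T \<Longrightarrow> internal_vertex C v \<Longrightarrow> (b, c) \<in> framing C v \<Longrightarrow> b \<noteq> c \<Longrightarrow> \<not> T b \<and> T c"
  unfolding levels_def by blast

text \<open>
  No ascending or descending string of edges of \<open>C\<close> passes through a blocked half-edge and its vertex.
\<close>

definition blocked :: "('v, 'e) framed_chart \<Rightarrow> ('e half_edge \<Rightarrow> bool) \<Rightarrow> 'e half_edge \<Rightarrow> bool" where
  "blocked C T h \<longleftrightarrow>
     (\<forall>z \<in> half_edges_at C (attach C h). z \<noteq> h \<longrightarrow> (h, z) \<notin> sim C (attach C h) \<longrightarrow> T z = T h)"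

text \<open>The three conjuncts prepare steepness, the internal end of each edge, and the absence of
  monotone bands, in this order.\<close>

definition good_edge :: "('v, 'e) framed_chart \<Rightarrow> ('e half_edge \<Rightarrow> bool) \<Rightarrow> 'e \<Rightarrow> bool" where
  "good_edge C T e \<longleftrightarrow>
     T (e, True) \<noteq> T (e, False) \<and> (\<exists>b. internal_vertex C (attach C (e, b))) \<and> (\<exists>b. blocked C T (e, b))"

text \<open>High are the half-edges with a strict predecessor. If such a half-edge also had a strict
  successor, that successor would be third in its class.\<close>

lemma levels_exist:
  assumes "framed_turbulence_chart D" "third_or_higher D = {}"
  obtains T where "levels D T"
proof
  let ?T = "\<lambda>z. \<exists>v b. internal_vertex D v \<and> b \<noteq> z \<and> (b, z) \<in> framing D v"
  show "levels D ?T"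
    unfolding levels_def
  proof (intro allI impI conjI)
    fix v b c assume v: "internal_vertex D v" "(b, c) \<in> framing D v" "b \<noteq> c"
    then show "?T c" by blast
    show "\<not> ?T b"
    proof
      assume "?T b"
      then obtain v' b' where v': "internal_vertex D v'" "b' \<noteq> b" "(b', b) \<in> framing D v'" by blast
      note A = framed_pair_at[OF assms(1) v(1)] and A' = framed_pair_at[OF assms(1) v'(1)]
      have "b \<in> half_edges_at D v" "b \<in> half_edges_at D v'"
        using framed_pair_field[OF A framed_pair_le[OF A v(2)]]
          framed_pair_field[OF A' framed_pair_le[OF A' v'(3)]] by blast+
      then have "v' = v"
        by (simp add: half_edges_at_iff)
      then have "c \<in> third_or_higher D"
        using v v' unfolding third_or_higher_def by blast
      then show False
        using assms(2) by blast
    qed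
  qed
qed

text \<open>
  Subdividing at \<open>q\<close> while flipping the level of \<open>q\<close> makes the new edge good in any case, and the old
  edge if its two half-edges had equal levels. So at most two subdivisions repair an edge.
\<close>

locale subdivision =
  fixes D :: "('v, 'e) framed_chart" and q :: "'e half_edge" and w :: 'v and a :: 'e
  assumes framed': "framed_turbulence_chart D" and q: "fst q \<in> edges D"
    and w': "w \<notin> verts D" and a': "a \<notin> edges D"

sublocale subdivision \<subseteq> expansion D "attach D q" "{q}" q w a
proof
  show "attach D q \<in> verts D"
    using framed' q by (cases q) (auto simp: framed_turbulence_chart_iff finite_graph_def half_edges_iff)
  show q': "{q} \<subseteq> half_edges_at D (attach D q)"
    using q by (simp add: half_edges_at_iff)
  show "(g, g') \<in> sim D (attach D q)" if "internal_vertex D (attach D q)" "g \<in> {q}" "g' \<in> {q}" for g g'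
    using framed_pair_refl[OF framed_pair_at[OF framed' that(1)]]
      framed_pair_le[OF framed_pair_at[OF framed' that(1)]] that q' by auto
qed (use framed' w' a' in auto)

context subdivision
begin

text \<open>The half-edge \<open>y\<close> takes the place of \<open>q\<close> in its old class and
  so must inherit the level of \<open>q\<close>. At \<open>w\<close> both classes are singletons and
  impose nothing; giving \<open>q\<close> and \<open>x\<close> the same level blocks both of them
  there, and the flip makes the levels of \<open>x\<close> and \<open>y\<close> opposite.\<close>

definition shift :: "('e half_edge \<Rightarrow> bool) \<Rightarrow> 'e half_edge \<Rightarrow> bool" where
  "shift T = T(q := \<not> T q, y := T q, x := \<not> T q)"

lemma shift_simps:
  "shift T q = (\<not> T q)" "shift T y = T q" "shift T x = (\<not> T q)"
  "fst z \<in> edges D \<Longrightarrow> z \<noteq> q \<Longrightarrow> shift T z = T z"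
  using q a by (auto simp: shift_def)

lemma shift_at_v: "z \<in> half_edges_at E (attach D q) \<Longrightarrow> shift T z = T (p z)"
  using a q by (auto simp: half_edges_at_expand half_edges_at_iff shift_simps)

lemma levels_shift:
  assumes T: "levels D T"
  shows "levels E (shift T)"
  unfolding levels_def
proof (intro allI impI)
  fix u b c assume u: "internal_vertex E u" "(b, c) \<in> framing E u" "b \<noteq> c"
  consider "u = w" | "u = attach D q" | "u \<noteq> w" "u \<noteq> attach D q" by blast
  then show "\<not> shift T b \<and> shift T c"
  proof cases
    case 1
    then show ?thesis
      using u(2,3) by (auto simp: framing_expand)
  next
    case 2
    have *: "(p b, p c) \<in> framing D u" "b \<in> half_edges_at E (attach D q)" "c \<in> half_edges_at E (attach D q)"
      using u(2) fresh(1) unfolding 2 framing_expand by auto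
    have "p b \<noteq> p c"
      using p_neq[OF *(2,3) u(3)] .
    moreover have "internal_vertex D u"
      using u(1) fresh(1) by (simp add: internal_expand 2)
    ultimately show ?thesis
      using levelsD[OF T _ *(1)] shift_at_v[OF *(2)] shift_at_v[OF *(3)] by metis
  next
    case 3
    then have i: "internal_vertex D u" "(b, c) \<in> framing D u"
      using u by (simp_all add: internal_expand framing_expand)
    note A = framed_pair_at[OF framed i(1)]
    have "b \<in> half_edges_at D u" "c \<in> half_edges_at D u"
      using framed_pair_field[OF A framed_pair_le[OF A i(2)]] by blast+
    then have "shift T b = T b" "shift T c = T c"
      using 3(2) shift_simps(4) by (metis half_edges_at_iff)+
    then show ?thesis
      using levelsD[OF T i u(3)] by simp
  qed
qed

text \<open>Seen from \<open>h\<close>, its vertex looks as before: at most \<open>q\<close> has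
  been replaced by \<open>y\<close>, in the same class and with the same level.\<close>

lemma blocked_shift:
  assumes "blocked D T h" "fst h \<in> edges D" "h \<noteq> q"
  shows "blocked E (shift T) h"
proof -
  define u where "u = attach D h"
  have h: "h \<in> half_edges_at D u" "h \<noteq> y" "h \<noteq> x"
    using assms(2) a by (auto simp: half_edges_at_iff u_def)
  have at: "attach E h = u"
    using h assms(3) by (simp add: expand_graph_simps u_def)
  have uw: "u \<noteq> w"
    using w attach_verts[OF assms(2)] by (auto simp: u_def)
  have "shift T z = shift T h" if z: "z \<in> half_edges_at E u" "z \<noteq> h" "(h, z) \<notin> sim E u" for z
  proof (cases "u = attach D q")
    case True
    have hE: "h \<in> half_edges_at E u"
      using h assms(3) True by (simp add: half_edges_at_expand)
    have "(p h, p z) \<notin> sim D u" "p z \<noteq> h" "p z \<in> half_edges_at D u"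
      using z hE h(2) assms(3) uw q True
      by (auto simp: sim_expand half_edges_at_expand half_edges_at_iff split: if_splits)
    then have "T (p z) = T h"
      using assms(1) h(2) unfolding blocked_def u_def[symmetric] by auto
    moreover have "shift T z = T (p z)" "shift T h = T h"
      using shift_at_v[of z T] shift_at_v[of h T] z(1) hE h(2) True by auto
    ultimately show ?thesis by simp
  next
    case False
    have zu: "z \<in> half_edges_at D u" "(h, z) \<notin> sim D u"
      using z False uw by (simp_all add: half_edges_at_expand sim_expand)
    then have "T z = T h"
      using assms(1) z(2) unfolding blocked_def u_def[symmetric] by blast
    moreover have "shift T z = T z" "shift T h = T h"
      using zu(1) False assms(2,3) by (auto simp: half_edges_at_iff intro!: shift_simps)
    ultimately show ?thesis by simp
  qed
  then show ?thesis
    unfolding blocked_def at by blast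
qed

lemma good_edge_shift:
  assumes "good_edge D T e" "e \<in> edges D" "e \<noteq> fst q"
  shows "good_edge E (shift T) e"
proof -
  have "shift T (e, b) = T (e, b)" for b
    using assms(2,3) by (intro shift_simps) auto
  moreover have "attach E (e, b) = attach D (e, b)" for b
    using assms(2,3) a by (auto simp: expand_graph_simps)
  moreover have "blocked D T (e, b) \<Longrightarrow> blocked E (shift T) (e, b)" for b
    using assms(2,3) by (intro blocked_shift) auto
  ultimately show ?thesis
    using assms(1) unfolding good_edge_def by (auto simp: internal_expand)
qed

lemma at_w: "half_edges_at E w = {x, q}" "attach E x = w" "attach E q = w"
  using fresh(1) q a by (auto simp: half_edges_at_expand expand_graph_simps)

lemma good_edge_new: "good_edge E (shift T) a"
proof -
  have "blocked E (shift T) x"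
    unfolding blocked_def at_w by (auto simp: shift_simps)
  moreover have "internal_vertex E (attach E x)"
    by (simp add: at_w internal_expand)
  ultimately show ?thesis
    unfolding good_edge_def by (auto simp: shift_simps)
qed

lemma good_edge_subdivided:
  assumes "T q = T (other_half q)"
  shows "good_edge E (shift T) (fst q)"
proof -
  have o: "shift T (other_half q) = T (other_half q)"
    using q other_half_neq[of q] by (intro shift_simps) auto
  have "blocked E (shift T) q"
    unfolding blocked_def at_w by (auto simp: shift_simps)
  moreover have "internal_vertex E (attach E q)"
    by (simp add: at_w internal_expand)
  moreover have "shift T (fst q, True) \<noteq> shift T (fst q, False)"
    using o assms shift_simps(1)[of T] by (cases q; cases "snd q") auto
  ultimately show ?thesis
    unfolding good_edge_def by (metis prod.collapse)
qed

end

text \<open>In the measure a bad edge counts once if its ends have equal levels and twice if they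
  have opposite levels. Subdividing the second kind leaves an edge with equal levels, subdividing
  the first kind repairs it; the new edge is good and good edges stay good.\<close>

lemma realizable_if_good_edges:
  assumes base: "\<And>D T. framed_turbulence_chart D \<Longrightarrow> levels D T \<Longrightarrow> \<forall>e \<in> edges D. good_edge D T e \<Longrightarrow> realizable D"
    and "framed_turbulence_chart D" "levels D T"
  shows "realizable D"
  using assms(2,3)
proof (induction "card {e \<in> edges D. \<not> good_edge D T e} +
    card {e \<in> edges D. \<not> good_edge D T e \<and> T (e, True) \<noteq> T (e, False)}"
    arbitrary: D T rule: less_induct)
  case less
  define bad where "bad D T = {e \<in> edges D. \<not> good_edge D T e}" for D :: "(nat, nat) framed_chart" and T
  define alt where "alt D T = {e \<in> edges D. \<not> good_edge D T e \<and> T (e, True) \<noteq> T (e, False)}"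
    for D :: "(nat, nat) framed_chart" and T
  have fin: "finite_graph D"
    using less.prems by (simp add: framed_turbulence_chart_iff)
  then have fb: "finite (bad D T)" "finite (alt D T)"
    by (auto simp: bad_def alt_def finite_graph_def)
  show ?case
  proof (cases "bad D T = {}")
    case True
    then show ?thesis
      using base less.prems unfolding bad_def by blast
  next
    case False
    then obtain e where e: "e \<in> bad D T" by blast
    obtain w a where wa: "w \<notin> verts D" "a \<notin> edges D"
      using obtain_fresh[OF fin] .
    interpret subdivision D "(e, False)" w a
      using less.prems(1) wa e by unfold_locales (auto simp: bad_def)
    have sh: "shift T (e', b) = T (e', b)" if "e' \<in> edges D" "e' \<noteq> e" for e' b
      using that by (intro shift_simps) auto
    have ba: "bad E (shift T) \<subseteq> bad D T" "alt E (shift T) - {e} \<subseteq> alt D T"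
      using good_edge_shift[of T] good_edge_new[of T] sh e by (auto simp: bad_def alt_def expand_graph_simps)
    have "card (bad E (shift T)) + card (alt E (shift T)) < card (bad D T) + card (alt D T)"
    proof (cases "T (e, False) = T (e, True)")
      case True
      then have "good_edge E (shift T) e"
        using good_edge_subdivided[of T] by simp
      then have "e \<notin> bad E (shift T)" "e \<notin> alt E (shift T)"
        by (auto simp: bad_def alt_def)
      then have "bad E (shift T) \<subset> bad D T" "alt E (shift T) \<subseteq> alt D T"
        using ba e by auto
      then show ?thesis
        using psubset_card_mono[OF fb(1)] card_mono[OF fb(2)] by (meson add_less_le_mono)
    next
      case False
      have "shift T (e, True) = T (e, True)"
        using e by (intro shift_simps) (auto simp: bad_def)
      then have "e \<notin> alt E (shift T)" "e \<in> alt D T"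
        using False e shift_simps(1)[of T] by (auto simp: bad_def alt_def)
      then have "alt E (shift T) \<subset> alt D T"
        using ba by auto
      then show ?thesis
        using psubset_card_mono[OF fb(2)] card_mono[OF fb(1) ba(1)] by (meson add_le_less_mono)
    qed
    then have "realizable E"
      using less.hyps[OF _ framed_expand levels_shift[OF less.prems(2)]] unfolding bad_def alt_def by blast
    then show ?thesis
      using realizable_expand[OF expansion_axioms] by blast
  qed
qed

subsection \<open>Completing a chart with dead-end edges\<close>

definition completable :: "(nat, nat) framed_chart \<Rightarrow> bool" where
  "completable D \<longleftrightarrow> (\<exists>C' W. gentle C' \<and> W \<subseteq> edges C' \<and> agree (delete_edges C' W) D)"

lemma realizable_if_completable: "completable D \<Longrightarrow> realizable D"
  unfolding completable_def realizable_def by blast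

section \<open>Deletion of edges and its compatibility with agreement\<close>

lemma delete_edges_graph_simps:
  "verts (delete_edges C W) = {v \<in> verts C. \<exists>z. fst z \<in> edges C - W \<and> attach C z = v}"
  "edges (delete_edges C W) = edges C - W"
  "attach (delete_edges C W) = attach C"
  by (auto simp: delete_edges_def Let_def)

lemma half_edges_at_delete_edges:
  "half_edges_at (delete_edges C W) v = {z \<in> half_edges_at C v. fst z \<notin> W}"
  by (auto simp: half_edges_at_iff delete_edges_graph_simps)

text \<open>A surviving vertex keeps at least one half-edge, which excludes cardinality zero. If it
  is internal afterwards it keeps at least two, and so had at least two before.\<close>

lemma internal_vertex_delete_edges:
  assumes "finite_graph C" "internal_vertex (delete_edges C W) v"
  shows "internal_vertex C v"
proof -
  let ?H = "half_edges_at (delete_edges C W) v"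
  have v: "v \<in> verts C" "card ?H \<noteq> 1" "\<exists>z. fst z \<in> edges C - W \<and> attach C z = v"
    using assms(2) by (auto simp: internal_vertex_iff delete_edges_graph_simps)
  then obtain z where "z \<in> ?H"
    by (auto simp: half_edges_at_delete_edges half_edges_at_iff)
  have "finite ?H"
    using finite_half_edges_at[OF assms(1), of v] by (simp add: half_edges_at_delete_edges)
  then have "card ?H \<noteq> 0"
    using \<open>z \<in> ?H\<close> by auto
  moreover have "card ?H \<le> card (half_edges_at C v)"
    using finite_half_edges_at[OF assms(1)] by (intro card_mono) (auto simp: half_edges_at_delete_edges)
  ultimately show ?thesis
    using v by (simp add: internal_vertex_iff)
qed

lemma agree_delete_edges:
  assumes "agree A B" "finite_graph B"
  shows "agree (delete_edges A W) (delete_edges B W)"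
proof -
  have g: "verts A = verts B" "edges A = edges B" "\<And>z. fst z \<in> edges B \<Longrightarrow> attach A z = attach B z"
    using assms(1) by (auto simp: agree_def half_edges_iff)
  have "sim (delete_edges A W) v = sim (delete_edges B W) v \<and>
      framing (delete_edges A W) v = framing (delete_edges B W) v"
    if "internal_vertex (delete_edges B W) v" for v
    using internal_vertex_delete_edges[OF assms(2) that] assms(1) g
    by (simp add: delete_edges_def Let_def agree_def)
  moreover have "verts (delete_edges A W) = verts (delete_edges B W)"
    using g by (auto simp: delete_edges_graph_simps) (metis fst_conv)+
  ultimately show ?thesis
    using g unfolding agree_def by (auto simp: delete_edges_graph_simps half_edges_iff)
qed

lemma delete_edges_delete_edges: "delete_edges (delete_edges C W) W' = delete_edges C (W \<union> W')"
proof -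
  have "(edges C - (W \<union> W')) \<times> UNIV = (edges C - W) \<times> UNIV \<inter> (edges C - W - W') \<times> (UNIV :: bool set)"
    by auto
  then show ?thesis
    unfolding delete_edges_def Let_def by (auto simp: fun_eq_iff)
qed

text \<open>Equality may fail, because deletion also restricts the arbitrary relations at vertices
  that are not internal.\<close>

lemma delete_edges_empty:
  assumes "framed_turbulence_chart C"
  shows "agree (delete_edges C {}) C"
proof -
  have "\<exists>z. fst z \<in> edges C \<and> attach C z = v" if "v \<in> verts C" for v
    by (rule ex_half_edge) (use assms that in \<open>simp_all add: framed_turbulence_chart_iff\<close>)
  then have "verts (delete_edges C {}) = verts C"
    by (auto simp: delete_edges_graph_simps)
  moreover have "sim (delete_edges C {}) v = sim C v \<and> framing (delete_edges C {}) v = framing C v"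
    if "internal_vertex C v" for v
  proof -
    note A = framed_pair_at[OF assms that]
    have "sim C v \<subseteq> (edges C \<times> UNIV) \<times> (edges C \<times> UNIV)"
      using framed_pair_field[OF A] by (auto simp: half_edges_at_iff)
    moreover have "framing C v \<subseteq> sim C v"
      using framed_pair_le[OF A] by auto
    ultimately show ?thesis
      by (auto simp: delete_edges_def Let_def)
  qed
  ultimately show ?thesis
    unfolding agree_def by (auto simp: delete_edges_graph_simps)
qed

text \<open>
  Weaker than \<^const>\<open>blocked\<close>, since the dead-end edges that complete a chart give every path through
  an internal vertex a continuation.
\<close>

definition nearly_blocked :: "('v, 'e) framed_chart \<Rightarrow> ('e half_edge \<Rightarrow> bool) \<Rightarrow> 'e half_edge \<Rightarrow> bool" where
  "nearly_blocked C T h \<longleftrightarrow>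
     (\<forall>z \<in> half_edges_at C (attach C h). z \<noteq> h \<longrightarrow> (h, z) \<notin> sim C (attach C h) \<longrightarrow>
        T z = T h \<or> fringe_vertex C (attach C (other_half z)))"

definition nice_edge :: "('v, 'e) framed_chart \<Rightarrow> ('e half_edge \<Rightarrow> bool) \<Rightarrow> 'e \<Rightarrow> bool" where
  "nice_edge C T e \<longleftrightarrow>
     T (e, True) \<noteq> T (e, False) \<and> (\<exists>b. internal_vertex C (attach C (e, b))) \<and> (\<exists>b. nearly_blocked C T (e, b))"

lemma nice_edge_if_good_edge: "good_edge C T e \<Longrightarrow> nice_edge C T e"
  unfolding good_edge_def nice_edge_def blocked_def nearly_blocked_def by blast

definition singletons :: "('v, 'e) framed_chart \<Rightarrow> 'e half_edge set" where
  "singletons C = {z \<in> half_edges C. internal_vertex C (attach C z) \<and>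
     (\<forall>z'. (z, z') \<in> sim C (attach C z) \<longrightarrow> z' = z)}"

locale completion =
  fixes D :: "('v, 'e) framed_chart" and z :: "'e half_edge" and T :: "'e half_edge \<Rightarrow> bool"
    and w :: 'v and a :: 'e
  assumes framed: "framed_turbulence_chart D" and levels: "levels D T"
    and nice: "\<And>e. e \<in> edges D \<Longrightarrow> nice_edge D T e"
    and z: "z \<in> singletons D" and w: "w \<notin> verts D" and a: "a \<notin> edges D"
begin

abbreviation "v \<equiv> attach D z"
abbreviation "d \<equiv> (a, False)"
abbreviation "d' \<equiv> (a, True)"

definition E :: "('v, 'e) framed_chart" where
  "E = \<lparr> verts = insert w (verts D),
         edges = insert a (edges D),
         attach = (attach D)(d := v, d' := w),
         sim = (sim D)(v := sim D v \<union> {(d, d), (d, z), (z, d)}),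
         framing = (framing D)(v := framing D v \<union> {(d, d), if T z then (d, z) else (z, d)}) \<rparr>"

text \<open>The level of \<open>d\<close> is opposite to that of its partner \<open>z\<close>, in
  accordance with the order chosen in \<open>E\<close>; \<open>d'\<close> is opposite to
  \<open>d\<close>, so that the new edge will be steep.\<close>

definition T' :: "'e half_edge \<Rightarrow> bool" where
  "T' = T(d := \<not> T z, d' := T z)"

lemma internal_v: "internal_vertex D v"
  and z_edge: "fst z \<in> edges D"
  and z_singleton: "(z, z') \<in> sim D v \<Longrightarrow> z' = z"
  using z unfolding singletons_def half_edges_iff by blast+

lemma v_verts: "v \<in> verts D"
  using internal_v by (simp add: internal_vertex_iff)

lemma at_v: "framed_pair (half_edges_at D v) (sim D v) (framing D v)"
  by (rule framed_pair_at[OF framed internal_v])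

lemma E_graph_simps:
  "verts E = insert w (verts D)"
  "edges E = insert a (edges D)"
  "attach E h = (if h = d then v else if h = d' then w else attach D h)"
  by (simp_all add: E_def)

lemma fresh: "d \<noteq> z" "w \<noteq> v" "d \<notin> half_edges_at D u" "d' \<notin> half_edges_at D u"
  using a z_edge w v_verts by (auto simp: half_edges_at_iff)

lemma attach_verts: "fst h \<in> edges D \<Longrightarrow> attach D h \<in> verts D"
  using framed by (cases h) (auto simp: framed_turbulence_chart_iff finite_graph_def half_edges_iff)

lemma half_edges_at_E:
  "half_edges_at E u =
     (if u = v then insert d (half_edges_at D v) else if u = w then {d'} else half_edges_at D u)"
proof -
  have "h = d \<or> h = d'" if "fst h = a" for h
    using that by (cases h) auto
  then show ?thesis
    using w attach_verts fresh(2) a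
    by (auto simp: half_edges_at_iff E_graph_simps split: if_splits)
qed

lemma finite_E: "finite_graph E"
proof -
  have D: "finite (verts D)" "finite (edges D)"
    "\<And>u. u \<in> verts D \<Longrightarrow> half_edges_at D u \<noteq> {}"
    using framed by (auto simp: framed_turbulence_chart_iff finite_graph_def)
  show ?thesis
    unfolding finite_graph_def
  proof (intro conjI ballI)
    show "attach E h \<in> verts E" if "h \<in> half_edges E" for h
      using that v_verts attach_verts by (cases h) (auto simp: half_edges_iff E_graph_simps)
    show "half_edges_at E u \<noteq> {}" if "u \<in> verts E" for u
      using that D(3) by (auto simp: half_edges_at_E E_graph_simps)
  qed (use D in \<open>auto simp: E_graph_simps\<close>)
qed

lemma internal_E: "internal_vertex E u \<longleftrightarrow> internal_vertex D u"
proof -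
  have "internal_vertex E v"
    using internal_vertexI[OF finite_E, of v d z] fresh(1) z_edge v_verts
    by (auto simp: half_edges_at_E E_graph_simps half_edges_at_iff)
  moreover have "\<not> internal_vertex E w" "\<not> internal_vertex D w"
    using fresh(2) w by (auto simp: internal_vertex_iff half_edges_at_E)
  moreover have "internal_vertex E u \<longleftrightarrow> internal_vertex D u" if "u \<noteq> v" "u \<noteq> w"
    using that by (simp add: internal_vertex_iff half_edges_at_E E_graph_simps)
  ultimately show ?thesis
    using internal_v by blast
qed

lemma fringe_E: "fringe_vertex D u \<Longrightarrow> fringe_vertex E u" "fringe_vertex E w"
  using internal_E[of u] internal_E[of w] w unfolding internal_vertex_def
  by (auto simp: E_graph_simps fringe_vertex_def)

lemma sim_E: "sim E u = (if u = v then sim D v \<union> {(d, d), (d, z), (z, d)} else sim D u)"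
  and framing_E: "framing E u =
    (if u = v then framing D v \<union> {(d, d), if T z then (d, z) else (z, d)} else framing D u)"
  by (simp_all add: E_def)

lemma framed_E_v: "framed_pair (half_edges_at E v) (sim E v) (framing E v)"
proof -
  note A = at_v
  have zH: "z \<in> half_edges_at D v"
    using z_edge by (simp add: half_edges_at_iff)
  have zz: "(z, z) \<in> framing D v"
    using framed_pair_refl[OF A zH] .
  have dS: "(d, b) \<notin> sim D v" "(b, d) \<notin> sim D v" "(d, b) \<notin> framing D v" "(b, d) \<notin> framing D v" for b
    using framed_pair_field[OF A] framed_pair_le[OF A] fresh(3) by blast+
  have zS: "(z, b) \<in> sim D v \<Longrightarrow> b = z" "(b, z) \<in> sim D v \<Longrightarrow> b = z"
    "(z, b) \<in> framing D v \<Longrightarrow> b = z" "(b, z) \<in> framing D v \<Longrightarrow> b = z" for b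
    using z_singleton framed_pair_sym[OF A] framed_pair_le[OF A] by blast+
  have S: "sim E v = sim D v \<union> {(d, d), (d, z), (z, d)}"
    and R: "framing E v = framing D v \<union> {(d, d), if T z then (d, z) else (z, d)}"
    and H: "half_edges_at E v = insert d (half_edges_at D v)"
    by (simp_all add: sim_E framing_E half_edges_at_E)
  show ?thesis
    unfolding S R H
  proof (rule framed_pairI, goal_cases)
    case (1 b c)
    then show ?case using framed_pair_field[OF A, of b c] zH by auto
  next
    case (2 b c)
    then show ?case using framed_pair_le[OF A, of b c] by (auto split: if_splits)
  next
    case (3 b)
    then show ?case using framed_pair_refl[OF A, of b] by auto
  next
    case (4 b c)
    then show ?case using framed_pair_total[OF A, of b c] by auto
  next
    case (5 b c)
    then show ?case using framed_pair_antisym[OF A, of b c] dS(3,4)[of z] fresh(1) by (auto split: if_splits)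
  next
    case (6 b c e)
    then show ?case using framed_pair_trans[OF A, of b c e] fresh(1)
      dS(3,4)[of b] dS(3,4)[of e] zS(4)[of b] zS(3)[of e] by (auto split: if_splits)
  next
    case (7 b c)
    then show ?case using framed_pair_sym[OF A, of b c] by auto
  next
    case (8 b c e)
    have zz': "(z, z) \<in> sim D v"
      using framed_pair_le[OF A zz] .
    show ?case
    proof (cases "(b, c) \<in> sim D v \<and> (c, e) \<in> sim D v")
      case True
      then show ?thesis
        using framed_pair_sim_trans[OF A, of b c e] by blast
    next
      case False
      \<comment> \<open>A pair involving \<open>d\<close> relates it only to itself and to
        \<open>z\<close>, and \<open>z\<close> was alone in its class. A chain that uses a new pair
        therefore stays within \<open>d\<close> and \<open>z\<close>.\<close>
      then have "b \<in> {d, z}" "e \<in> {d, z}"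
        using 8 zS(1)[of e] zS(2)[of b] dS(1)[of e] dS(2)[of b] by auto
      then show ?thesis
        using zz' by auto
    qed
  next
    case 9
    obtain b c where bc: "b \<in> half_edges_at D v" "c \<in> half_edges_at D v" "(b, c) \<notin> sim D v"
      using framed_pair_nontrivial[OF A] by blast
    moreover have "b \<noteq> d" "c \<noteq> d"
      using bc fresh(3)[of v] by auto
    ultimately show ?case
      by (intro bexI[of _ b] bexI[of _ c]) simp_all
  next
    case (10 b c e)
    \<comment> \<open>As \<open>z\<close> was alone, all remaining old half-edges form the other
      class. Membership in the pair of \<open>d\<close> and \<open>z\<close> thus decides the class,
      and two of any three elements agree on it.\<close>
    have other: "(b, c) \<in> sim D v" if "b \<in> half_edges_at D v" "c \<in> half_edges_at D v" "b \<noteq> z" "c \<noteq> z" for b c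
      using framed_pair_two[OF A that(1) zH that(2)] zS that by blast
    have same: "(b, c) \<in> sim D v \<union> {(d, d), (d, z), (z, d)}"
      if "b \<in> insert d (half_edges_at D v)" "c \<in> insert d (half_edges_at D v)" "b \<in> {d, z} \<longleftrightarrow> c \<in> {d, z}" for b c
      using that other[of b c] framed_pair_le[OF A zz] by auto
    show ?case
      using same[OF 10(1,2)] same[OF 10(2,3)] same[OF 10(1,3)] by argo
  qed
qed

lemma framed_E: "framed_turbulence_chart E"
  unfolding framed_turbulence_chart_iff
proof (intro conjI allI impI finite_E)
  fix u assume u: "internal_vertex E u"
  have "u \<noteq> w"
    using u[unfolded internal_E] w by (auto simp: internal_vertex_iff)
  then show "framed_pair (half_edges_at E u) (sim E u) (framing E u)"
    using u framed_E_v framed_pair_at[OF framed, of u]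
    by (cases "u = v") (simp_all add: internal_E half_edges_at_E sim_E framing_E)
qed

lemma T'_simps: "T' d = (\<not> T z)" "T' d' = T z" "fst h \<in> edges D \<Longrightarrow> T' h = T h"
  using a by (auto simp: T'_def)

lemma levels_E: "levels E T'"
  unfolding levels_def
proof (intro allI impI)
  fix u b c assume u: "internal_vertex E u" "(b, c) \<in> framing E u" "b \<noteq> c"
  have i: "internal_vertex D u"
    using u(1) by (simp add: internal_E)
  note A = framed_pair_at[OF framed i]
  show "\<not> T' b \<and> T' c"
  proof (cases "(b, c) \<in> framing D u")
    case True
    have "fst b \<in> edges D" "fst c \<in> edges D"
      using framed_pair_field[OF A framed_pair_le[OF A True]] by (auto simp: half_edges_at_iff)
    then show ?thesis
      using levelsD[OF levels i True u(3)] by (simp add: T'_simps)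
  next
    case False
    then have "(b, c) = (if T z then (d, z) else (z, d))"
      using u by (auto simp: framing_E split: if_splits)
    then show ?thesis
      using T'_simps(3)[OF z_edge] by (auto simp: T'_simps split: if_splits)
  qed
qed

text \<open>The only new half-edge that can appear opposite \<open>h\<close> is \<open>d\<close>,
  and its edge ends at the fringe vertex \<open>w\<close>. Old fringe ends stay fringe, since dead
  ends are attached at internal vertices only.\<close>

lemma nearly_blocked_E:
  assumes "nearly_blocked D T h" "fst h \<in> edges D"
  shows "nearly_blocked E T' h"
proof -
  define u where "u = attach D h"
  have h: "attach E h = u" "T' h = T h" "h \<in> half_edges_at D u"
    using assms(2) a T'_simps(3) by (auto simp: E_graph_simps u_def half_edges_at_iff)
  have uw: "u \<noteq> w"
    using w attach_verts[OF assms(2)] u_def by auto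
  have "T' k = T' h \<or> fringe_vertex E (attach E (other_half k))"
    if k: "k \<in> half_edges_at E u" "k \<noteq> h" "(h, k) \<notin> sim E u" for k
  proof (cases "k = d")
    case True
    then show ?thesis
      using fringe_E(2) by (simp add: E_graph_simps)
  next
    case False
    then have k': "k \<in> half_edges_at D u" "(h, k) \<notin> sim D u"
      using k uw by (auto simp: half_edges_at_E sim_E split: if_splits)
    then have "T k = T h \<or> fringe_vertex D (attach D (other_half k))"
      using assms(1) k(2) unfolding nearly_blocked_def u_def[symmetric] by blast
    moreover have "T' k = T k" "attach E (other_half k) = attach D (other_half k)"
      using k'(1) a T'_simps(3) by (auto simp: half_edges_at_iff E_graph_simps dest!: arg_cong[of _ _ fst])
    ultimately show ?thesis
      using fringe_E(1) h(2) by auto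
  qed
  then show ?thesis
    unfolding nearly_blocked_def h(1) by blast
qed

lemma nice_E: "e \<in> edges E \<Longrightarrow> nice_edge E T' e"
proof (cases "e = a")
  case True
  \<comment> \<open>This holds vacuously, \<open>d'\<close> being the only half-edge at
    \<open>w\<close>.\<close>
  have "nearly_blocked E T' d'"
    using fresh(2) unfolding nearly_blocked_def by (simp add: E_graph_simps half_edges_at_E)
  moreover have "internal_vertex E (attach E d)"
    by (simp add: E_graph_simps internal_E internal_v)
  ultimately show ?thesis
    unfolding nice_edge_def True by (auto simp: T'_simps)
next
  case False
  assume "e \<in> edges E"
  then have e: "e \<in> edges D"
    using False by (simp add: E_graph_simps)
  have "attach E (e, b) = attach D (e, b)" "T' (e, b) = T (e, b)" for b
    using False e by (simp_all add: E_graph_simps T'_simps)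
  then show ?thesis
    using nice[OF e] e nearly_blocked_E unfolding nice_edge_def internal_E by fastforce
qed

lemma singletons_E: "singletons E \<subseteq> singletons D - {z}"
proof
  fix h assume "h \<in> singletons E"
  then have h: "fst h \<in> edges E" "internal_vertex E (attach E h)"
    "\<And>h'. (h, h') \<in> sim E (attach E h) \<Longrightarrow> h' = h"
    by (auto simp: singletons_def half_edges_iff)
  have "d' \<noteq> z"
    using z_edge a by auto
  then have "h \<noteq> d" "h \<noteq> z"
    using h(3)[of z] h(3)[of d] fresh(1) by (auto simp: E_graph_simps sim_E)
  moreover have "h \<noteq> d'"
    using h(2) fringe_E(2) by (auto simp: E_graph_simps internal_vertex_def)
  moreover from calculation have "attach E h = attach D h"
    by (simp add: E_graph_simps)
  moreover have "fst h \<in> edges D"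
    using calculation h(1) by (cases h) (auto simp: E_graph_simps)
  moreover have "sim D u \<subseteq> sim E u" for u
    by (auto simp: sim_E)
  ultimately show "h \<in> singletons D - {z}"
    using h(2,3) unfolding singletons_def half_edges_iff internal_E by auto
qed

lemma delete_E: "agree (delete_edges E {a}) D"
  unfolding agree_def
proof (intro conjI ballI allI impI)
  show "edges (delete_edges E {a}) = edges D"
    using a by (auto simp: delete_edges_graph_simps E_graph_simps)
  show "attach (delete_edges E {a}) h = attach D h" if "h \<in> half_edges D" for h
    using that a by (auto simp: delete_edges_graph_simps E_graph_simps half_edges_iff)
  have "\<exists>h. fst h \<in> edges D \<and> attach D h = u" if "u \<in> verts D" for u
    by (rule ex_half_edge) (use framed that in \<open>simp_all add: framed_turbulence_chart_iff\<close>)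
  moreover have "fst h \<noteq> a \<and> h \<noteq> d \<and> h \<noteq> d'" if "fst h \<in> edges D" for h
    using that a by auto
  ultimately show "verts (delete_edges E {a}) = verts D"
    using a w attach_verts by (auto simp: delete_edges_graph_simps E_graph_simps) metis+
  fix u assume i: "internal_vertex D u"
  note A = framed_pair_at[OF framed i]
  have H: "(edges E - {a}) \<times> UNIV = edges D \<times> UNIV"
    using a by (auto simp: E_graph_simps)
  have *: "(b, c) \<in> sim D u \<Longrightarrow> fst b \<in> edges D \<and> fst c \<in> edges D"
    "(b, c) \<in> framing D u \<Longrightarrow> fst b \<in> edges D \<and> fst c \<in> edges D" for b c
    using framed_pair_field[OF A, of b c] framed_pair_le[OF A, of b c] by (auto simp: half_edges_at_iff)
  show "sim (delete_edges E {a}) u = sim D u" "framing (delete_edges E {a}) u = framing D u"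
    unfolding delete_edges_def Let_def H using * a by (auto simp: sim_E framing_E split: if_splits)
qed

end

lemma completable_completion:
  assumes "completion D z T w a" "completable (completion.E D z T w a)"
  shows "completable D"
proof -
  obtain C' W where C': "gentle C'" "W \<subseteq> edges C'" "agree (delete_edges C' W) (completion.E D z T w a)"
    using assms(2) unfolding completable_def by blast
  have "agree (delete_edges (delete_edges C' W) {a}) (delete_edges (completion.E D z T w a) {a})"
    using agree_delete_edges[OF C'(3) completion.finite_E[OF assms(1)]] .
  then have "agree (delete_edges C' (W \<union> {a})) D"
    using agree_trans completion.delete_E[OF assms(1)] by (metis delete_edges_delete_edges)
  moreover have "a \<in> edges C'"
    using C'(3) completion.E_graph_simps(2)[OF assms(1)]
    by (auto simp: agree_def delete_edges_graph_simps)
  ultimately show ?thesis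
    unfolding completable_def using C'(1,2) by (intro exI[of _ C'] exI[of _ "W \<union> {a}"]) auto
qed

subsection \<open>Gentleness of the completed chart\<close>

text \<open>That \<open>B @ B\<close> is a string makes \<open>B\<close> cyclic, so the last edge is
  followed by the first.\<close>

lemma band_neighbours:
  assumes "band C B" "e \<in> set B"
  shows "\<exists>e' \<in> set B. composable C e e'" "\<exists>e' \<in> set B. composable C e' e"
proof -
  let ?n = "length B"
  have c: "\<And>j. Suc j < length (B @ B) \<Longrightarrow> composable C ((B @ B) ! j) ((B @ B) ! Suc j)"
    using assms(1) unfolding band_def chart_string_def by blast
  have s: "(B @ B) ! j \<in> set B" if "j < length (B @ B)" for j
    using nth_mem[OF that] by simp
  obtain i where i: "i < ?n" "B ! i = e"
    using assms(2) by (auto simp: in_set_conv_nth)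
  have "(B @ B) ! i = e"
    using i by (simp add: nth_append)
  then show "\<exists>e' \<in> set B. composable C e e'"
    using c[of i] s[of "Suc i"] i(1) by auto
  \<comment> \<open>The predecessor is taken before the occurrence of \<open>e\<close> in the second
    copy of \<open>B\<close>, which also covers \<open>i = 0\<close>.\<close>
  have n: "Suc (?n + i - 1) = ?n + i"
    using i(1) by simp
  then have "(B @ B) ! Suc (?n + i - 1) = e"
    using i(2) by (simp only: nth_append_length_plus)
  then show "\<exists>e' \<in> set B. composable C e' e"
    using c[of "?n + i - 1"] s[of "?n + i - 1"] i(1) n by auto
qed

locale complete_chart =
  fixes D :: "('v, 'e) framed_chart" and T :: "'e half_edge \<Rightarrow> bool"
  assumes framed: "framed_turbulence_chart D" and levels: "levels D T"
    and nice: "\<And>e. e \<in> edges D \<Longrightarrow> nice_edge D T e" and no_singletons: "singletons D = {}"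
begin

lemma partner:
  assumes "z \<in> half_edges_at D v" "internal_vertex D v"
  obtains z' where "z' \<noteq> z" "(z, z') \<in> sim D v"
    "if T z then (z', z) \<in> framing D v else (z, z') \<in> framing D v"
proof -
  note A = framed_pair_at[OF framed assms(2)]
  have "z \<notin> singletons D"
    using no_singletons by simp
  then obtain z' where z': "z' \<noteq> z" "(z, z') \<in> sim D v"
    using assms by (auto simp: singletons_def half_edges_at_iff half_edges_iff)
  then show ?thesis
    using that framed_pair_total[OF A z'(2)] levelsD[OF levels assms(2), of z z']
      levelsD[OF levels assms(2), of z' z] by (metis (full_types))
qed

text \<open>Distinct members of a class are comparable and so have different levels. There are only
  two levels, hence at most two members; \<open>partner\<close> provides the second.\<close>

lemma full: "full_chart D"
  unfolding full_chart_def
proof (intro allI impI ballI)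
  fix v c assume v: "internal_vertex D v" and "c \<in> classes_at D v"
  note A = framed_pair_at[OF framed v]
  obtain z where z: "z \<in> half_edges_at D v" "c = sim D v `` {z}"
    using \<open>c \<in> classes_at D v\<close> unfolding classes_at_def by (rule quotientE)
  obtain z' where z': "z' \<noteq> z" "(z, z') \<in> sim D v"
    "if T z then (z', z) \<in> framing D v else (z, z') \<in> framing D v"
    using partner[OF z(1) v] .
  have "u = z \<or> u = z'" if u: "(z, u) \<in> sim D v" for u
  proof (rule ccontr)
    assume n: "\<not> (u = z \<or> u = z')"
    have diff: "T b \<noteq> T c" if "(b, c) \<in> sim D v" "b \<noteq> c" for b c
      using framed_pair_total[OF A that(1)] levelsD[OF levels v, of b c] levelsD[OF levels v, of c b] that(2)
      by blast
    have "(z', u) \<in> sim D v"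
      using framed_pair_sim_trans[OF A framed_pair_sym[OF A z'(2)] u] .
    then show False
      using diff[OF u] diff[OF z'(2)] diff[of z' u] n z'(1) by blast
  qed
  then have "c = {z, z'}"
    using z(2) z'(2) framed_pair_le[OF A framed_pair_refl[OF A z(1)]] by auto
  then show "card c = 2"
    using z'(1) by simp
qed

lemma lonely_iff: "lonely D z \<longleftrightarrow> z \<in> half_edges D \<and> \<not> internal_vertex D (attach D z)"
proof (cases "z \<in> half_edges D")
  case True
  then have v: "attach D z \<in> verts D"
    using framed by (auto simp: framed_turbulence_chart_iff finite_graph_def)
  have "{z} \<notin> classes_at D (attach D z)" if "internal_vertex D (attach D z)"
    using full that unfolding full_chart_def by fastforce
  then show ?thesis
    using True v by (auto simp: lonely_def internal_vertex_def)
qed (simp add: lonely_def)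

text \<open>Every half-edge at an internal vertex now has a partner, so its level is real and
  \<open>levels\<close> identifies it with \<open>T\<close>. At a fringe vertex a half-edge is
  lonely for either value of \<open>T\<close>.\<close>

lemma high_iff:
  assumes "z \<in> half_edges D" "internal_vertex D (attach D z)"
  shows "high D z \<longleftrightarrow> T z"
proof
  let ?v = "attach D z"
  have z: "z \<in> half_edges_at D ?v"
    using assms by (simp add: half_edges_at_def)
  show "T z" if "high D z"
    using that levelsD[OF levels assms(2)] unfolding high_def by blast
  show "high D z" if "T z"
  proof -
    obtain z' where z': "z' \<noteq> z" "(z, z') \<in> sim D ?v"
      "if T z then (z', z) \<in> framing D ?v else (z, z') \<in> framing D ?v"
      using partner[OF z assms(2)] .
    moreover have "(z', z) \<in> sim D ?v"
      using framed_pair_sym[OF framed_pair_at[OF framed assms(2)] z'(2)] .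
    moreover have "\<not> lonely D z"
      using assms(2) by (simp add: lonely_iff)
    ultimately show ?thesis
      unfolding high_def using that assms(1) by (metis (full_types))
  qed
qed

lemma low_or_lonely_iff:
  "z \<in> half_edges D \<Longrightarrow> low D z \<or> lonely D z \<longleftrightarrow> (internal_vertex D (attach D z) \<longrightarrow> \<not> T z)"
  using high_iff[of z] by (auto simp: low_def lonely_iff)

lemma high_or_lonely_iff:
  "z \<in> half_edges D \<Longrightarrow> high D z \<or> lonely D z \<longleftrightarrow> (internal_vertex D (attach D z) \<longrightarrow> T z)"
  using high_iff[of z] by (auto simp: high_def lonely_iff)

text \<open>At the nearly blocked end of an edge of \<open>B\<close>, the neighbouring edge of the
  band is attached by a half-edge of the opposite class and the opposite level. Its far end would
  have to be fringe, whereas all vertices along a band are internal. The parameter \<open>t\<close>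
  treats ascending and descending bands together.\<close>

lemma no_monotone_band:
  assumes "band D B" and t: "\<And>e. e \<in> set B \<Longrightarrow> T (fst e) = t \<and> T (snd e) \<noteq> t"
  shows False
proof -
  have or: "fst (fst e) \<in> edges D" "snd e = other_half (fst e)" if "e \<in> set B" for e
    using assms(1) that unfolding band_def chart_string_def oriented_edge_def by (auto simp: half_edges_iff)
  have int: "internal_vertex D (attach D (fst e))" "internal_vertex D (attach D (snd e))" if "e \<in> set B" for e
    using band_neighbours[OF assms(1) that] by (auto simp: composable_def)
  obtain e where e: "e \<in> set B"
    using assms(1) by (cases B) (auto simp: band_def chart_string_def)
  obtain b where b: "nearly_blocked D T (fst (fst e), b)"
    using nice[OF or(1)[OF e]] unfolding nice_edge_def by blast
  have "(fst (fst e), b) = fst e \<or> (fst (fst e), b) = snd e"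
    using fst_eq_cases[of "(fst (fst e), b)" "fst e"] or(2)[OF e] by simp
  then consider "nearly_blocked D T (fst e)" | "nearly_blocked D T (snd e)"
    using b by auto
  then show False
  proof cases
    case 1
    obtain e' where e': "e' \<in> set B" "composable D e' e"
      using band_neighbours(2)[OF assms(1) e] by blast
    let ?v = "attach D (fst e)"
    have c: "attach D (snd e') = ?v" "(snd e', fst e) \<notin> sim D ?v"
      using e'(2) by (auto simp: composable_def)
    then have "(fst e, snd e') \<notin> sim D ?v"
      using framed_pair_sym[OF framed_pair_at[OF framed int(1)[OF e]]] by blast
    moreover have "snd e' \<in> half_edges_at D ?v"
      using c(1) or[OF e'(1)] by (simp add: half_edges_at_iff)
    moreover have "T (snd e') \<noteq> T (fst e)"
      using t[OF e] t[OF e'(1)] by simp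
    moreover from this have "snd e' \<noteq> fst e"
      by auto
    ultimately have "fringe_vertex D (attach D (other_half (snd e')))"
      using 1 unfolding nearly_blocked_def by blast
    then show False
      using int(1)[OF e'(1)] or(2)[OF e'(1)] by (simp add: internal_vertex_def)
  next
    case 2
    obtain e' where e': "e' \<in> set B" "composable D e e'"
      using band_neighbours(1)[OF assms(1) e] by blast
    let ?v = "attach D (snd e)"
    have c: "attach D (fst e') = ?v" "(snd e, fst e') \<notin> sim D ?v"
      using e'(2) by (auto simp: composable_def)
    moreover have "fst e' \<in> half_edges_at D ?v"
      using c(1) or(1)[OF e'(1)] by (simp add: half_edges_at_iff)
    moreover have "T (fst e') \<noteq> T (snd e)"
      using t[OF e] t[OF e'(1)] by simp
    moreover from this have "fst e' \<noteq> snd e"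
      by auto
    ultimately have "fringe_vertex D (attach D (other_half (fst e')))"
      using 2 unfolding nearly_blocked_def by blast
    then show False
      using int(2)[OF e'(1)] or(2)[OF e'(1)] by (simp add: internal_vertex_def)
  qed
qed

lemma gentle: "gentle D"
  unfolding gentle_def
proof (intro conjI ballI notI framed full)
  fix e assume e: "e \<in> edges D"
  show "\<exists>b. internal_vertex D (attach D (e, b))"
    using nice[OF e] by (simp add: nice_edge_def)
  \<comment> \<open>The edge is oriented from its low to its high end; an end at a fringe vertex is
    lonely and fits both requirements.\<close>
  obtain b where b: "\<not> T (e, b)" "T (e, \<not> b)"
    using nice[OF e] unfolding nice_edge_def by (metis (full_types))
  have "ascending D ((e, b), (e, \<not> b))"
    using e b low_or_lonely_iff[of "(e, b)"] high_or_lonely_iff[of "(e, \<not> b)"]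
    by (simp add: ascending_def oriented_edge_def half_edges_iff)
  then show "steep D e"
    unfolding steep_def ascending_def by (intro exI[of _ "((e, b), (e, \<not> b))"]) (auto simp: ascending_def)
next
  assume "\<exists>B. band D B \<and> (Ball (set B) (ascending D) \<or> Ball (set B) (descending D))"
  then obtain B where B: "band D B" "Ball (set B) (ascending D) \<or> Ball (set B) (descending D)"
    by blast
  have or: "fst e \<in> half_edges D" "snd e \<in> half_edges D" if "e \<in> set B" for e
    using B(1) that unfolding band_def chart_string_def oriented_edge_def by (auto simp: half_edges_iff)
  have int: "internal_vertex D (attach D (fst e))" "internal_vertex D (attach D (snd e))" if "e \<in> set B" for e
    using band_neighbours[OF B(1) that] by (auto simp: composable_def)
  from B(2) show False
  proof
    assume asc: "Ball (set B) (ascending D)"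
    have "T (fst e) = False \<and> T (snd e) \<noteq> False" if "e \<in> set B" for e
      using asc that int[OF that] low_or_lonely_iff[OF or(1)[OF that]] high_or_lonely_iff[OF or(2)[OF that]]
      by (auto simp: ascending_def)
    then show False
      by (rule no_monotone_band[OF B(1)])
  next
    assume desc: "Ball (set B) (descending D)"
    have "T (fst e) = True \<and> T (snd e) \<noteq> True" if "e \<in> set B" for e
      using desc that int[OF that] high_or_lonely_iff[OF or(1)[OF that]] low_or_lonely_iff[OF or(2)[OF that]]
      by (auto simp: descending_def)
    then show False
      by (rule no_monotone_band[OF B(1)])
  qed
qed

end

lemma completable_if_nice_edges:
  assumes "framed_turbulence_chart D" "levels D T" "\<And>e. e \<in> edges D \<Longrightarrow> nice_edge D T e"
  shows "completable D"
  using assms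
proof (induction "card (singletons D)" arbitrary: D T rule: less_induct)
  case less
  have fin: "finite_graph D"
    using less.prems(1) by (simp add: framed_turbulence_chart_iff)
  show ?case
  proof (cases "singletons D = {}")
    case True
    then have "complete_chart D T"
      using less.prems by unfold_locales auto
    then have "gentle D"
      by (rule complete_chart.gentle)
    then show ?thesis
      unfolding completable_def using delete_edges_empty[OF less.prems(1)] by blast
  next
    case False
    then obtain z where z: "z \<in> singletons D" by blast
    obtain w a where "w \<notin> verts D" "a \<notin> edges D"
      using obtain_fresh[OF fin] .
    then have c: "completion D z T w a"
      using less.prems z by unfold_locales auto
    have "finite (singletons D)"
      using fin by (auto simp: singletons_def finite_graph_def half_edges_def)
    then have "card (singletons (completion.E D z T w a)) < card (singletons D)"
      using completion.singletons_E[OF c] z by (intro psubset_card_mono) auto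
    then have "completable (completion.E D z T w a)"
      using less.hyps[OF _ completion.framed_E[OF c] completion.levels_E[OF c] completion.nice_E[OF c]] by blast
    then show ?thesis
      by (rule completable_completion[OF c])
  qed
qed

subsection \<open>The theorem\<close>

lemma realizable_nat:
  assumes "framed_turbulence_chart D"
  shows "realizable D"
proof (rule realizable_if_small_classes[OF _ assms])
  fix D :: "(nat, nat) framed_chart"
  assume D: "framed_turbulence_chart D" "third_or_higher D = {}"
  then obtain T where "levels D T"
    using levels_exist by blast
  with D(1) show "realizable D"
    by (rule realizable_if_good_edges[rotated])
      (meson realizable_if_completable completable_if_nice_edges nice_edge_if_good_edge)
qed

text \<open>The construction keeps adding vertices and edges, and the types of the given chart may
  be finite. A copy over the natural numbers always leaves fresh names.\<close>

lemma nat_copy: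
  fixes C :: "('v, 'e) framed_chart"
  assumes C: "framed_turbulence_chart C"
  obtains C0 :: "(nat, nat) framed_chart" where "framed_turbulence_chart C0" "chart_iso C0 C"
proof -
  have fin: "finite (verts C)" "finite (edges C)" "finite_graph C"
    using C by (auto simp: framed_turbulence_chart_iff finite_graph_def)
  obtain g where g: "bij_betw g {0..<card (verts C)} (verts C)"
    using ex_bij_betw_nat_finite[OF fin(1)] by blast
  obtain f where f: "bij_betw f {0..<card (edges C)} (edges C)"
    using ex_bij_betw_nat_finite[OF fin(2)] by blast
  define V where "V = {0..<card (verts C)}"
  define N where "N = {0..<card (edges C)}"
  define \<chi> where "\<chi> z = (f (fst z), snd z)" for z :: "nat half_edge"
  define att where "att z = inv_into V g (attach C (\<chi> z))" for z
  define H where "H n = {z \<in> N \<times> UNIV. att z = n}" for n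
  define C0 where "C0 = \<lparr> verts = V, edges = N, attach = att,
      sim = (\<lambda>n. {(y, z) \<in> H n \<times> H n. (\<chi> y, \<chi> z) \<in> sim C (g n)}),
      framing = (\<lambda>n. {(y, z) \<in> H n \<times> H n. (\<chi> y, \<chi> z) \<in> framing C (g n)}) \<rparr>"
  have gV: "bij_betw g V (verts C)" and fN: "bij_betw f N (edges C)"
    using f g by (simp_all add: V_def N_def)
  have half: "half_edges C0 = N \<times> UNIV"
    by (simp add: half_edges_def C0_def)
  have \<chi>_bij: "bij_betw \<chi> (N \<times> UNIV) (half_edges C)"
    unfolding bij_betw_def
  proof
    show "inj_on \<chi> (N \<times> UNIV)"
      using fN by (auto simp: inj_on_def \<chi>_def bij_betw_def)
    show "\<chi> ` (N \<times> UNIV) = half_edges C"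
      using fN by (force simp: \<chi>_def half_edges_def bij_betw_def image_iff)
  qed
  then have \<chi>_inj: "inj_on \<chi> (N \<times> UNIV)" and \<chi>_im: "\<chi> ` (N \<times> UNIV) = half_edges C"
    by (auto simp: bij_betw_def)
  have attach_C: "attach C z \<in> verts C" if "z \<in> half_edges C" for z
    using C that by (auto simp: framed_turbulence_chart_iff finite_graph_def)
  have att: "g (att z) = attach C (\<chi> z)" "att z \<in> V" if "z \<in> N \<times> UNIV" for z
  proof -
    have "\<chi> z \<in> half_edges C"
      using \<chi>_im that by blast
    then have "attach C (\<chi> z) \<in> g ` V"
      using attach_C gV by (simp add: bij_betw_def)
    then show "g (att z) = attach C (\<chi> z)" "att z \<in> V"
      unfolding att_def by (auto intro: f_inv_into_f inv_into_into)
  qed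
  have HC0: "half_edges_at C0 n = H n" for n
    unfolding half_edges_at_def half by (simp add: H_def C0_def)
  have H: "\<chi> ` H n = half_edges_at C (g n)" if "n \<in> V" for n
  proof -
    have "att z = n \<longleftrightarrow> attach C (\<chi> z) = g n" if "z \<in> N \<times> UNIV" for z
      using att[OF that] \<open>n \<in> V\<close> gV unfolding bij_betw_def by (metis inj_onD)
    then show ?thesis
      unfolding H_def half_edges_at_def \<chi>_im[symmetric] by blast
  qed
  have H_inj: "inj_on \<chi> (H n)" for n
    using \<chi>_inj by (rule inj_on_subset) (auto simp: H_def)
  have int: "internal_vertex C (g n)" if "internal_vertex C0 n" for n
  proof -
    have n: "n \<in> V" "card (H n) \<noteq> 1"
      using that HC0 by (auto simp: internal_vertex_iff C0_def)
    then show ?thesis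
      using card_image[OF H_inj, of n] H[OF n(1)] gV
      by (auto simp: internal_vertex_iff bij_betw_def)
  qed
  have intV: "n \<in> V" if "internal_vertex C0 n" for n
    using that by (simp add: internal_vertex_iff C0_def)
  have framed: "framed_turbulence_chart C0"
    unfolding framed_turbulence_chart_iff
  proof (intro conjI allI impI)
    show "finite_graph C0"
      unfolding finite_graph_def half
    proof (intro conjI ballI)
      show "half_edges_at C0 n \<noteq> {}" if "n \<in> verts C0" for n
      proof -
        have n: "n \<in> V" "g n \<in> verts C"
          using that gV by (auto simp: C0_def bij_betw_def)
        then show ?thesis
          using fin(3) H[OF n(1)] unfolding HC0 finite_graph_def by auto
      qed
    qed (use att in \<open>auto simp: C0_def V_def N_def\<close>)
    fix n assume i: "internal_vertex C0 n"
    note A = framed_pair_at[OF C int[OF i]]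
    have "\<exists>x\<in>H n. \<exists>y\<in>H n. (\<chi> x, \<chi> y) \<notin> sim C (g n)"
      using framed_pair_nontrivial[OF A] unfolding H[OF intV[OF i], symmetric] by blast
    then have "framed_pair (H n) {(y, z) \<in> H n \<times> H n. (\<chi> y, \<chi> z) \<in> sim C (g n)}
        {(y, z) \<in> H n \<times> H n. (\<chi> y, \<chi> z) \<in> framing C (g n)}"
      using framed_pair_pullback[OF A H_inj] H[OF intV[OF i]] by blast
    then show "framed_pair (half_edges_at C0 n) (sim C0 n) (framing C0 n)"
      unfolding HC0 by (simp add: C0_def)
  qed
  have "chart_iso C0 C"
    unfolding chart_iso_def half HC0
  proof (rule exI[of _ g], rule exI[of _ \<chi>], intro conjI ballI allI impI)
    show "bij_betw g (verts C0) (verts C)"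
      using gV by (simp add: C0_def)
    show "bij_betw \<chi> (N \<times> UNIV) (half_edges C)"
      by (fact \<chi>_bij)
    show "\<chi> (other_half z) = other_half (\<chi> z)" for z
      by (cases z) (simp add: \<chi>_def)
    show "attach C (\<chi> z) = g (attach C0 z)" if "z \<in> N \<times> UNIV" for z
      using att(1)[OF that] by (simp add: C0_def)
  qed (auto simp: C0_def)
  then show ?thesis
    using that framed by blast
qed

lemma agree_chart_iso:
  assumes "agree A B" "chart_iso B C"
  shows "chart_iso A C"
proof -
  have "verts A = verts B" "half_edges A = half_edges B" "\<forall>x \<in> half_edges B. attach A x = attach B x"
    "\<And>v. internal_vertex B v \<Longrightarrow> sim A v = sim B v \<and> framing A v = framing B v"
    using assms(1) by (auto simp: agree_def half_edges_def)
  then show ?thesis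
    using assms(2) unfolding chart_iso_def agree_internal_vertex[OF assms(1)] agree_half_edges_at[OF assms(1)]
    by (elim exE) (intro exI, auto)
qed

theorem theorem7p10:
  fixes C :: "('v, 'e) framed_chart"
  assumes "framed_turbulence_chart C"
  shows "\<exists>(C' :: (nat, nat) framed_chart) W D.
           gentle C' \<and> W \<subseteq> edges C' \<and>
           contraction_step\<^sup>*\<^sup>* (delete_edges C' W) D \<and>
           chart_iso D C"
proof -
  obtain C0 :: "(nat, nat) framed_chart" where C0: "framed_turbulence_chart C0" "chart_iso C0 C"
    using nat_copy[OF assms] .
  have "realizable C0"
    using C0(1) by (rule realizable_nat)
  then show ?thesis
    unfolding realizable_def using agree_chart_iso[OF _ C0(2)] by blast
qed

end
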